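(* Let $W(E_8^{(1)})=\langle w_0,w_1,\dots,w_8\rangle$ act on the parameters $u_1,\dots,u_8,b$ and the variables $F,G$ as described in the context, and let $\Omega$ be the subgroup of those $\rho\in W(E_8^{(1)})$ for which $\rho(u_1)=\rho(u_2)$, $\rho(u_3)=\rho(u_4)$, $\rho(u_5)=\rho(u_6)$, $\rho(u_7)=\rho(u_8)$ hold whenever $u_1=u_2$, $u_3=u_4$, $u_5=u_6$, $u_7=u_8$. Put $$r_1=w_3w_4w_8w_3,\qquad r_2=w_5w_4w_6w_5,\qquad r_3=w_7w_6w_0w_7 .$$ Then the symmetry group obtained from $\Omega$ by quotienting out the elements which act as the identity on the parameters and variables under the conditions $u_1=u_2$, $u_3=u_4$, $u_5=u_6$, $u_7=u_8$ is the group $\langle w_1,w_2,r_1,r_2,r_3\rangle$ generated by (the classes of) $w_1,w_2,r_1,r_2,r_3$, and it is an affine Weyl group of type $F_4^{(1)}$: $$\langle w_1,w_2,r_1,r_2,r_3\rangle = W(F_4^{(1)}),$$ where $w_1,w_2,r_1,r_2,r_3$ are, in this order along the Dynkin diagram, the Coxeter generators. That is, this group is isomorphic to the Coxeter group with these generators and the defining relations $$w_1^2=w_2^2=r_1^2=r_2^2=r_3^2=1,$$ $$(w_1w_2)^3=(w_1r_1)^2=(w_1r_2)^2=(w_1r_3)^2=1,$$ $$(w_2r_1)^4=(w_2r_2)^2=(w_2r_3)^2=(r_1r_2)^3=(r_1r_3)^2=(r_2r_3)^3=1 .$$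
   Context: $W(E_8^{(1)})=\langle w_0,\dots,w_8\rangle$ is the affine Weyl group of type $E_8^{(1)}$, with relations $w_i^2=1$ for all $i$; $(w_iw_{i+1})^3=1$ for $i=1,\dots,6$; $(w_0w_7)^3=1$; $(w_3w_8)^3=1$; and $(w_iw_j)^2=1$ for all other pairs $i\neq j$. It acts from the left (as automorphisms, so $(xy)(h)=x(y(h))$), linearly on the independent parameters $u_1,\dots,u_8,b$ and birationally on the variables $F,G$, as follows (anything not listed is fixed; $\wp$ is a fixed Weierstrass function): - $w_1:(b,F,G)\mapsto(-b,G,F)$; - $w_i:(u_{i-1},u_i)\mapsto(u_i,u_{i-1})$ for $i=3,\dots,7$; $w_0:(u_7,u_8)\mapsto(u_8,u_7)$; $w_8:(u_1,u_2)\mapsto(u_2,u_1)$; - $w_2(u_j)=u_j-\tfrac34(2b+u_1+u_2)$ for $j=1,2$; $w_2(u_j)=u_j+\tfrac14(2b+u_1+u_2)$ for $j=3,\dots,8$; $w_2(b)=b-\tfrac14(2b+u_1+u_2)$; $w_2(F)=F$; and $w_2(G)$ is determined by $$\frac{w_2(G)-\wp\left(2b-\frac{u_1-u_2}{2}\right)}{w_2(G)-\wp\left(2b+\frac{u_1-u_2}{2}\right)}=\frac{(F-\wp(u_2+b))(G-\wp(b-u_1))(\wp(2b)-\wp(b-u_2))}{(F-\wp(u_1+b))(G-\wp(b-u_2))(\wp(2b)-\wp(b-u_1))}\cdot\frac{\wp\left(b-\frac{u_1+u_2}{2}\right)-\wp\left(2b-\frac{u_1-u_2}{2}\right)}{\wp\left(b-\frac{u_1+u_2}{2}\right)-\wp\left(2b+\frac{u_1-u_2}{2}\right)}.$$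 On the subspace $u_1=u_2$, $u_3=u_4$, $u_5=u_6$, $u_7=u_8$ the birational action on $F,G$ is understood by continuation (limit) from generic parameters. *)

theory Defs
  imports "HOL-Analysis.Analysis" "HOL-Algebra.Coset" "HOL-Algebra.Generated_Groups"
begin

section \<open>Coxeter groups given by generators and relations\<close>

text \<open>
  Since \<open>m i i = 1\<close> makes every generator an involution, words without formal inverses suffice:
  the group presented by \<open>(s\<^sub>i s\<^sub>j)^(m i j) = 1\<close> is the monoid of words over \<open>I\<close> modulo
  the congruence generated by deleting relators.
\<close>

definition relator :: "(nat \<Rightarrow> nat \<Rightarrow> nat) \<Rightarrow> nat \<Rightarrow> nat \<Rightarrow> nat list" where
  "relator m i j = concat (replicate (m i j) [i, j])"

inductive cox_eq :: "nat set \<Rightarrow> (nat \<Rightarrow> nat \<Rightarrow> nat) \<Rightarrow> nat list \<Rightarrow> nat list \<Rightarrow> bool"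
  for I :: "nat set" and m :: "nat \<Rightarrow> nat \<Rightarrow> nat" where
  refl: "v \<in> lists I \<Longrightarrow> cox_eq I m v v"
| sym: "cox_eq I m v w \<Longrightarrow> cox_eq I m w v"
| trans: "cox_eq I m u v \<Longrightarrow> cox_eq I m v w \<Longrightarrow> cox_eq I m u w"
| relation: "v \<in> lists I \<Longrightarrow> w \<in> lists I \<Longrightarrow> i \<in> I \<Longrightarrow> j \<in> I
    \<Longrightarrow> cox_eq I m (v @ relator m i j @ w) (v @ w)"

definition cox_class :: "nat set \<Rightarrow> (nat \<Rightarrow> nat \<Rightarrow> nat) \<Rightarrow> nat list \<Rightarrow> nat list set" where
  "cox_class I m v = {w. cox_eq I m v w}"

definition coxeter_group :: "nat set \<Rightarrow> (nat \<Rightarrow> nat \<Rightarrow> nat) \<Rightarrow> nat list set monoid" where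
  "coxeter_group I m =
    \<lparr>carrier = cox_class I m ` lists I,
     mult = (\<lambda>\<rho> \<sigma>. \<Union>x\<in>\<rho>. \<Union>y\<in>\<sigma>. cox_class I m (x @ y)),
     one = cox_class I m []\<rparr>"

definition e8_matrix :: "nat \<Rightarrow> nat \<Rightarrow> nat" where
  "e8_matrix i j =
    (if i = j then 1
     else if {i, j} \<in> {{1,2}, {2,3}, {3,4}, {4,5}, {5,6}, {6,7}, {0,7}, {3,8}} then 3
     else 2)"

abbreviation W_E8 :: "nat list set monoid" where
  "W_E8 \<equiv> coxeter_group {..8} e8_matrix"

abbreviation W_E8_elem :: "nat list \<Rightarrow> nat list set" where
  "W_E8_elem v \<equiv> cox_class {..8} e8_matrix v"

text \<open>The generators \<open>0, 1, 2, 3, 4\<close> stand for \<open>w\<^sub>1, w\<^sub>2, r\<^sub>1, r\<^sub>2, r\<^sub>3\<close>.\<close>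

definition f4_matrix :: "nat \<Rightarrow> nat \<Rightarrow> nat" where
  "f4_matrix i j =
    (if i = j then 1
     else if {i, j} = {1,2} then 4
     else if {i, j} \<in> {{0,1}, {2,3}, {3,4}} then 3
     else 2)"

abbreviation W_F4 :: "nat list set monoid" where
  "W_F4 \<equiv> coxeter_group {..4} f4_matrix"


section \<open>The Weierstrass function\<close>

definition period_lattice :: "complex \<Rightarrow> complex \<Rightarrow> complex set" where
  "period_lattice \<omega>1 \<omega>2 = {of_int m * \<omega>1 + of_int n * \<omega>2 | m n. True}"

definition weierstrass_p :: "complex set \<Rightarrow> complex \<Rightarrow> complex" where
  "weierstrass_p L z = 1 / z^2 + (\<Sum>\<^sub>\<infinity>\<omega>\<in>L - {0}. 1 / (z - \<omega>)^2 - 1 / \<omega>^2)"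


section \<open>The action of the generators\<close>

text \<open>
  A parameter point is \<open>((u\<^sub>1, \<dots>, u\<^sub>8), b)\<close>; in the index type \<open>8\<close> the numeral \<open>8\<close>
  equals \<open>0\<close>, so that \<open>u $ 1, \<dots>, u $ 8\<close> are the eight distinct coordinates. A generator
  \<open>w\<^sub>i\<close> acts on functions by \<open>h \<mapsto> h \<circ> step i\<close>, where the coordinates of \<open>step i x\<close> are
  the values at \<open>x\<close> of the images of the coordinate functions under \<open>w\<^sub>i\<close>.
\<close>

type_synonym param = "(complex ^ 8) \<times> complex"
type_synonym point = "param \<times> complex \<times> complex"

definition coord_u :: "8 \<Rightarrow> param \<Rightarrow> complex" where "coord_u j p = fst p $ j"
definition coord_b :: "param \<Rightarrow> complex" where "coord_b p = snd p"
definition coord_F :: "point \<Rightarrow> complex" where "coord_F x = fst (snd x)"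
definition coord_G :: "point \<Rightarrow> complex" where "coord_G x = snd (snd x)"

definition swap_u :: "8 \<Rightarrow> 8 \<Rightarrow> param \<Rightarrow> param" where
  "swap_u i j = (\<lambda>(u, b). (\<chi> k. if k = i then u $ j else if k = j then u $ i else u $ k, b))"

definition w2_param :: "param \<Rightarrow> param" where
  "w2_param = (\<lambda>(u, b). let s = 2 * b + u $ 1 + u $ 2 in
     (\<chi> k. if k = 1 \<or> k = 2 then u $ k - 3 / 4 * s else u $ k + 1 / 4 * s, b - 1 / 4 * s))"

definition param_step :: "nat \<Rightarrow> param \<Rightarrow> param" where
  "param_step i p =
    (if i = 0 then swap_u 7 8 p
     else if i = 1 then (fst p, - snd p)
     else if i = 2 then w2_param p
     else if i = 3 then swap_u 2 3 p
     else if i = 4 then swap_u 3 4 p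
     else if i = 5 then swap_u 4 5 p
     else if i = 6 then swap_u 5 6 p
     else if i = 7 then swap_u 6 7 p
     else if i = 8 then swap_u 1 2 p
     else p)"

definition w2_G_eq :: "complex set \<Rightarrow> point \<Rightarrow> complex \<Rightarrow> bool" where
  "w2_G_eq L = (\<lambda>((u, b), F, G) Y.
    (let P = weierstrass_p L; u1 = u $ 1; u2 = u $ 2;
         A = P (2 * b - (u1 - u2) / 2); B = P (2 * b + (u1 - u2) / 2);
         C = P (b - (u1 + u2) / 2)
     in Y \<noteq> B \<and>
        (Y - A) / (Y - B) =
          ((F - P (u2 + b)) * (G - P (b - u1)) * (P (2 * b) - P (b - u2))) /
          ((F - P (u1 + b)) * (G - P (b - u2)) * (P (2 * b) - P (b - u1))) *
          ((C - A) / (C - B))))"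

text \<open>
  The points at which the formula for \<open>w\<^sub>2(G)\<close> makes sense: no argument of the Weierstrass
  function is a pole, no denominator vanishes, and there is exactly one finite solution. This
  fails on all of \<open>u\<^sub>1 = u\<^sub>2\<close>, where the two sides of the equation are identically \<open>1\<close>.
\<close>

definition w2_regular :: "complex set \<Rightarrow> point \<Rightarrow> bool" where
  "w2_regular L = (\<lambda>((u, b), F, G).
    (let P = weierstrass_p L; u1 = u $ 1; u2 = u $ 2
     in {2 * b - (u1 - u2) / 2, 2 * b + (u1 - u2) / 2, b - (u1 + u2) / 2,
         u1 + b, u2 + b, b - u1, b - u2, 2 * b} \<inter> L = {} \<and>
        F \<noteq> P (u1 + b) \<and> G \<noteq> P (b - u2) \<and> P (2 * b) \<noteq> P (b - u1) \<and>
        P (b - (u1 + u2) / 2) \<noteq> P (2 * b + (u1 - u2) / 2) \<and>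
        (\<exists>!Y. w2_G_eq L ((u, b), F, G) Y)))"

definition regular :: "complex set \<Rightarrow> nat \<Rightarrow> point \<Rightarrow> bool" where
  "regular L i x \<longleftrightarrow> (i = 2 \<longrightarrow> w2_regular L x)"

definition step :: "complex set \<Rightarrow> nat \<Rightarrow> point \<Rightarrow> point" where
  "step L i x =
    (param_step i (fst x),
     (if i = 1 then (coord_G x, coord_F x)
      else if i = 2 then (coord_F x, THE Y. w2_G_eq L x Y)
      else (coord_F x, coord_G x)))"


section \<open>The action of words\<close>

text \<open>Automorphisms acting from the left: \<open>(w\<^sub>i \<rho>)(h) = w\<^sub>i(\<rho>(h)) = \<rho>(h) \<circ> step i\<close>.\<close>

primrec word_act :: "(nat \<Rightarrow> 'x \<Rightarrow> 'x) \<Rightarrow> nat list \<Rightarrow> ('x \<Rightarrow> 'a) \<Rightarrow> 'x \<Rightarrow> 'a" where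
  "word_act st [] h = h"
| "word_act st (i # v) h = word_act st v h \<circ> st i"

primrec word_regular :: "complex set \<Rightarrow> nat list \<Rightarrow> point \<Rightarrow> bool" where
  "word_regular L [] x \<longleftrightarrow> True"
| "word_regular L (i # v) x \<longleftrightarrow> regular L i x \<and> word_regular L v (step L i x)"


section \<open>The symmetry group on the subspace\<close>

definition special :: "param set" where
  "special = {p. coord_u 1 p = coord_u 2 p \<and> coord_u 3 p = coord_u 4 p \<and>
                 coord_u 5 p = coord_u 6 p \<and> coord_u 7 p = coord_u 8 p}"

definition Omega :: "nat list set set" where
  "Omega = {\<rho> \<in> carrier W_E8. \<forall>v\<in>\<rho>. \<forall>p\<in>special.
     word_act param_step v (coord_u 1) p = word_act param_step v (coord_u 2) p \<and>
     word_act param_step v (coord_u 3) p = word_act param_step v (coord_u 4) p \<and>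
     word_act param_step v (coord_u 5) p = word_act param_step v (coord_u 6) p \<and>
     word_act param_step v (coord_u 7) p = word_act param_step v (coord_u 8) p}"

definition trivial_on_params :: "nat list set \<Rightarrow> bool" where
  "trivial_on_params \<rho> \<longleftrightarrow> (\<forall>v\<in>\<rho>. \<forall>p\<in>special.
     (\<forall>j. word_act param_step v (coord_u j) p = coord_u j p) \<and>
     word_act param_step v coord_b p = coord_b p)"

text \<open>
  The value at a point \<open>x0\<close> of the subspace is the limit from points at which \<open>v\<close> is regular,
  and the identity of birational maps is tested at the points of a dense open subset of the
  subspace.
\<close>

definition word_trivial_on_vars :: "complex set \<Rightarrow> nat list \<Rightarrow> bool" where
  "word_trivial_on_vars L v \<longleftrightarrow>
    (\<exists>D. openin (top_of_set (special \<times> UNIV)) D \<and> special \<times> UNIV \<subseteq> closure D \<and>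
      (\<forall>x0\<in>D. x0 islimpt {x. word_regular L v x} \<and>
        (word_act (step L) v coord_F \<longlongrightarrow> coord_F x0) (at x0 within {x. word_regular L v x}) \<and>
        (word_act (step L) v coord_G \<longlongrightarrow> coord_G x0) (at x0 within {x. word_regular L v x})))"

text \<open>
  The words in a class \<open>\<rho>\<close> are expressions, with different domains of definition, of one and
  the same birational map (the generators satisfy the Coxeter relations); any one of them may
  be used to continue it to the subspace.
\<close>

definition trivial_on_vars :: "complex set \<Rightarrow> nat list set \<Rightarrow> bool" where
  "trivial_on_vars L \<rho> \<longleftrightarrow> (\<exists>v\<in>\<rho>. word_trivial_on_vars L v)"

definition Omega_trivial :: "complex set \<Rightarrow> nat list set set" where
  "Omega_trivial L = {\<rho> \<in> Omega. trivial_on_params \<rho> \<and> trivial_on_vars L \<rho>}"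

abbreviation Omega_group :: "nat list set monoid" where
  "Omega_group \<equiv> W_E8\<lparr>carrier := Omega\<rparr>"

definition symmetry_group :: "complex set \<Rightarrow> nat list set set monoid" where
  "symmetry_group L = Omega_group Mod Omega_trivial L"

definition symmetry_class :: "complex set \<Rightarrow> nat list set \<Rightarrow> nat list set set" where
  "symmetry_class L \<rho> = Omega_trivial L #>\<^bsub>Omega_group\<^esub> \<rho>"

definition f4_gen :: "nat \<Rightarrow> nat list set" where
  "f4_gen k = W_E8_elem ([[1], [2], [3, 4, 8, 3], [5, 4, 6, 5], [7, 6, 0, 7]] ! k)"

end

theory Submission
  imports Defs
begin

text \<open>
  Both groups act by reflections on linear functions: \<open>W(E\<^sub>8\<^sup>(\<^sup>1\<^sup>))\<close> on all parameters, the group with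
  diagram \<open>F\<^sub>4\<^sup>(\<^sup>1\<^sup>)\<close> on the subspace \<open>\<alpha>\<^sub>0 = \<alpha>\<^sub>4 = \<alpha>\<^sub>6 = \<alpha>\<^sub>8 = 0\<close>, with the restrictions of
  \<open>\<alpha>\<^sub>1, \<alpha>\<^sub>2, \<alpha>\<^sub>3, \<alpha>\<^sub>5, \<alpha>\<^sub>7\<close> as simple roots. By the theorem of Tits, \<open>w(\<alpha>\<^sub>s)\<close> is a nonnegative
  combination of simple roots if \<open>w w\<^sub>s\<close> is longer than \<open>w\<close>, and a nonpositive one otherwise.
  Evaluating such combinations at a point of the subspace where the five remaining roots are
  positive and descending on the length, one finds that the pointwise stabilizer of the subspace is
  \<open>\<langle>w\<^sub>0, w\<^sub>4, w\<^sub>6, w\<^sub>8\<rangle>\<close>, which does not move \<open>F\<close> and \<open>G\<close>, so that the action on \<open>F\<close> and \<open>G\<close>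
  plays no further role. If \<open>w\<close> preserves the subspace and \<open>w w\<^sub>s\<close> is shorter than \<open>w\<close> for some
  \<open>s \<in> {1, 2, 3, 5, 7}\<close>, then so is the product of \<open>w\<close> with the corresponding generator among
  \<open>w\<^sub>1, w\<^sub>2, r\<^sub>1, r\<^sub>2, r\<^sub>3\<close>; hence these generate modulo the stabilizer. Their relations can be
  checked on the subspace, and there are no others by the theorem of Tits for \<open>F\<^sub>4\<^sup>(\<^sup>1\<^sup>)\<close>.
\<close>

section \<open>Coxeter groups as groups of words\<close>

declare in_listsI [rule del] in_listsD [rule del]

text \<open>Words act on functions by pullback, so the letter applied last to a function is the
  first to move the point. This turns statements about functions into statements about maps of
  points.\<close>

lemma word_act_eq_fold: "word_act st v h x = h (fold st v x)"
  by (induction v arbitrary: x) auto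

lemma relator_in_lists [simp]: "i \<in> I \<Longrightarrow> j \<in> I \<Longrightarrow> relator m i j \<in> lists I"
  by (auto simp: relator_def in_lists_conv_set split: if_splits)

lemma length_relator: "length (relator m i j) = 2 * m i j"
  by (simp add: relator_def length_concat sum_list_replicate)

lemma cox_eq_in_lists: "cox_eq I m v w \<Longrightarrow> v \<in> lists I \<and> w \<in> lists I"
  by (induction rule: cox_eq.induct) (auto simp flip: in_lists_conv_set)

lemma cox_eq_context:
  "cox_eq I m v w \<Longrightarrow> a \<in> lists I \<Longrightarrow> b \<in> lists I \<Longrightarrow> cox_eq I m (a @ v @ b) (a @ w @ b)"
proof (induction rule: cox_eq.induct)
  case (refl v)
  then show ?case by (intro cox_eq.refl) simp
next
  case (relation v w i j)
  then show ?case
    using cox_eq.relation[of "a @ v" I "w @ b" i j m] by simp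
qed (blast intro: cox_eq.sym cox_eq.trans)+

lemma cox_eq_append:
  assumes "cox_eq I m v v'" "cox_eq I m w w'"
  shows "cox_eq I m (v @ w) (v' @ w')"
proof (rule cox_eq.trans)
  show "cox_eq I m (v @ w) (v' @ w)"
    using cox_eq_context[OF assms(1), of "[]" w] cox_eq_in_lists[OF assms(2)] by simp
  show "cox_eq I m (v' @ w) (v' @ w')"
    using cox_eq_context[OF assms(2), of v' "[]"] cox_eq_in_lists[OF assms(1)] by simp
qed

text \<open>Every relator has even length, so parity is an invariant of the class: this is the sign
  character.\<close>

lemma cox_eq_even_length: "cox_eq I m v w \<Longrightarrow> even (length v) \<longleftrightarrow> even (length w)"
  by (induction rule: cox_eq.induct) (auto simp: length_relator)

lemma cox_eq_cong: "cox_eq I m v w \<Longrightarrow> cox_eq I m v x \<longleftrightarrow> cox_eq I m w x"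
  using cox_eq.trans[of I m v w x] cox_eq.trans[OF cox_eq.sym[of I m v w], of x] by blast

lemma cox_class_eq_iff:
  assumes "v \<in> lists I"
  shows "cox_class I m v = cox_class I m w \<longleftrightarrow> cox_eq I m v w"
proof
  assume "cox_class I m v = cox_class I m w"
  then have "cox_eq I m w v"
    using cox_eq.refl[OF assms, of m] unfolding cox_class_def by blast
  then show "cox_eq I m v w" by (rule cox_eq.sym)
next
  assume "cox_eq I m v w"
  then show "cox_class I m v = cox_class I m w"
    by (simp add: cox_class_def cox_eq_cong[of I m v w])
qed

lemma cox_class_self: "v \<in> lists I \<Longrightarrow> v \<in> cox_class I m v"
  by (simp add: cox_class_def cox_eq.refl)

lemma coxeter_group_carrier: "carrier (coxeter_group I m) = cox_class I m ` lists I"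
  and coxeter_group_one: "\<one>\<^bsub>coxeter_group I m\<^esub> = cox_class I m []"
  by (simp_all add: coxeter_group_def)

text \<open>The union defining the product collapses to one class because \<open>cox_eq\<close> is a
  congruence.\<close>

lemma coxeter_group_mult:
  assumes "v \<in> lists I" "w \<in> lists I"
  shows "cox_class I m v \<otimes>\<^bsub>coxeter_group I m\<^esub> cox_class I m w = cox_class I m (v @ w)"
proof -
  have "cox_class I m (x @ y) = cox_class I m (v @ w)"
    if "x \<in> cox_class I m v" "y \<in> cox_class I m w" for x y
  proof -
    have "cox_eq I m (v @ w) (x @ y)"
      using that by (simp add: cox_class_def cox_eq_append)
    then show ?thesis
      using assms by (subst eq_commute, subst cox_class_eq_iff) auto
  qed
  then have "(\<Union>x\<in>cox_class I m v. \<Union>y\<in>cox_class I m w. cox_class I m (x @ y))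
      = (\<Union>x\<in>cox_class I m v. \<Union>y\<in>cox_class I m w. cox_class I m (v @ w))"
    by simp
  also have "\<dots> = cox_class I m (v @ w)"
    using cox_class_self[OF assms(1), of m] cox_class_self[OF assms(2), of m] by blast
  finally show ?thesis
    by (simp add: coxeter_group_def)
qed

locale coxeter_words =
  fixes I :: "nat set" and m :: "nat \<Rightarrow> nat \<Rightarrow> nat"
  assumes diag: "i \<in> I \<Longrightarrow> m i i = 1"
begin

lemma square: "i \<in> I \<Longrightarrow> cox_eq I m [i, i] []"
  using cox_eq.relation[of "[]" I "[]" i i m] by (simp add: relator_def diag)

lemma append_rev: "v \<in> lists I \<Longrightarrow> cox_eq I m (v @ rev v) []"
proof (induction v)
  case Nil
  show ?case by (simp add: cox_eq.refl)
next
  case (Cons i v)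
  then have i: "i \<in> I" and v: "v \<in> lists I" by simp_all
  have "cox_eq I m ([i] @ (v @ rev v) @ [i]) ([i] @ [] @ [i])"
    by (rule cox_eq_context[OF Cons.IH[OF v]]) (simp_all add: i)
  then have "cox_eq I m ((i # v) @ rev (i # v)) [i, i]" by simp
  then show ?case
    by (rule cox_eq.trans[OF _ square[OF i]])
qed

lemma rev_append: "v \<in> lists I \<Longrightarrow> cox_eq I m (rev v @ v) []"
  using append_rev[of "rev v"] by (simp add: in_lists_conv_set)

text \<open>Moves the tail of a relation to the other side, which turns relators into braid
  relations; inverting a word means reversing it.\<close>

lemma eq_rev_of_append_eq_Nil:
  assumes "cox_eq I m (v @ w) []"
  shows "cox_eq I m v (rev w)"
proof -
  have l: "v \<in> lists I" "w \<in> lists I" "rev w \<in> lists I"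
    using cox_eq_in_lists[OF assms] by (auto simp: in_lists_conv_set)
  have "cox_eq I m (v @ w @ rev w) (v @ [])"
    by (intro cox_eq_append append_rev cox_eq.refl l)
  moreover have "cox_eq I m ((v @ w) @ rev w) ([] @ rev w)"
    by (intro cox_eq_append assms cox_eq.refl l)
  ultimately show ?thesis
    using cox_eq_cong[of I m "v @ w @ rev w" v "rev w"] by simp
qed

lemma group_coxeter_group: "group (coxeter_group I m)"
proof (rule groupI)
  fix x assume "x \<in> carrier (coxeter_group I m)"
  then obtain v where v: "x = cox_class I m v" "v \<in> lists I"
    by (auto simp: coxeter_group_carrier)
  have "rev v \<in> lists I" "cox_class I m (rev v @ v) = cox_class I m []"
    using v(2) rev_append by (auto simp: in_lists_conv_set cox_class_eq_iff)
  then show "\<exists>y\<in>carrier (coxeter_group I m). y \<otimes>\<^bsub>coxeter_group I m\<^esub> x = \<one>\<^bsub>coxeter_group I m\<^esub>"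
    using v by (auto simp: coxeter_group_carrier coxeter_group_mult coxeter_group_one
        intro!: bexI[of _ "rev v"])
qed (auto simp: coxeter_group_carrier coxeter_group_mult coxeter_group_one)

lemma inv_cox_class:
  assumes "v \<in> lists I"
  shows "inv\<^bsub>coxeter_group I m\<^esub> cox_class I m v = cox_class I m (rev v)"
proof -
  interpret G: group "coxeter_group I m" by (rule group_coxeter_group)
  have "rev v \<in> lists I" "cox_class I m (rev v @ v) = cox_class I m []"
    using assms rev_append by (auto simp: in_lists_conv_set cox_class_eq_iff)
  then show ?thesis
    using assms by (intro G.inv_equality)
      (auto simp: coxeter_group_carrier coxeter_group_mult coxeter_group_one)
qed

subsection \<open>Length\<close>

definition len :: "nat list \<Rightarrow> nat" where
  "len v = (LEAST n. \<exists>w. cox_eq I m v w \<and> length w = n)"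

lemma len_witness:
  assumes "v \<in> lists I"
  obtains w where "cox_eq I m v w" "length w = len v"
proof -
  have "\<exists>w. cox_eq I m v w \<and> length w = len v"
    unfolding len_def using cox_eq.refl[OF assms, of m] by (rule_tac LeastI) blast
  then show ?thesis using that by blast
qed

lemma len_le: "cox_eq I m v w \<Longrightarrow> len v \<le> length w"
  unfolding len_def by (rule Least_le) blast

lemma len_cong:
  assumes "cox_eq I m v w"
  shows "len v = len w"
  by (simp add: len_def cox_eq_cong[OF assms])

lemma len_append_le:
  assumes "v \<in> lists I" "w \<in> lists I"
  shows "len (v @ w) \<le> len v + length w"
proof -
  obtain v' where v': "cox_eq I m v v'" "length v' = len v"
    using len_witness[OF assms(1)] .
  show ?thesis
    using len_le[OF cox_eq_append[OF v'(1) cox_eq.refl[OF assms(2)]]] v'(2) by simp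
qed

lemma even_len:
  assumes "v \<in> lists I"
  shows "even (len v) \<longleftrightarrow> even (length v)"
proof -
  obtain w where "cox_eq I m v w" "length w = len v"
    using len_witness[OF assms] .
  then show ?thesis
    using cox_eq_even_length by metis
qed

lemma append_square:
  assumes "v \<in> lists I" "i \<in> I"
  shows "cox_eq I m (v @ [i, i]) v"
  using cox_eq_append[OF cox_eq.refl[OF assms(1)] square[OF assms(2)]] by simp

text \<open>As \<open>[i, i]\<close> is trivial, the two lengths differ by at most one, and parity
  excludes equality.\<close>

lemma len_snoc:
  assumes "v \<in> lists I" "i \<in> I"
  shows "len (v @ [i]) = Suc (len v) \<or> len v = Suc (len (v @ [i]))"
proof -
  have "len (v @ [i, i]) = len v"
    using append_square[OF assms] by (rule len_cong)
  then have "len v \<le> len (v @ [i]) + 1" "len (v @ [i]) \<le> len v + 1"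
    using len_append_le[of "v @ [i]" "[i]"] len_append_le[of v "[i]"] assms by auto
  moreover have "even (len (v @ [i])) \<noteq> even (len v)"
    using even_len[of v] even_len[of "v @ [i]"] assms by simp
  then have "len (v @ [i]) \<noteq> len v" by auto
  ultimately show ?thesis by linarith
qed

text \<open>The last letter of a shortest representative can be cancelled.\<close>

lemma descent_exists:
  assumes "v \<in> lists I" "\<not> cox_eq I m v []"
  obtains s where "s \<in> I" "len (v @ [s]) < len v"
proof -
  obtain w where w: "cox_eq I m v w" "length w = len v"
    using len_witness[OF assms(1)] .
  then have "w \<noteq> []" using assms(2) by auto
  then obtain w' s where ws: "w = w' @ [s]" by (metis rev_exhaust)
  have l: "s \<in> I" "w' \<in> lists I"
    using cox_eq_in_lists[OF w(1)] ws by auto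
  have "cox_eq I m (v @ [s]) (w @ [s])"
    using cox_eq_append[OF w(1) cox_eq.refl[of "[s]"]] l by simp
  also have "cox_eq I m (w @ [s]) w'"
    using append_square l ws by simp
  finally (cox_eq.trans) have "len (v @ [s]) \<le> length w'" by (rule len_le)
  then show ?thesis using that l w ws by simp
qed

end


section \<open>Realizations and the theorem of Tits\<close>

text \<open>The functions \<open>root i\<close> are the simple roots, evaluated on points that the
  generators reflect. The products \<open>cartan i j * cartan j i\<close> are 0, 1, 2, that is 4
  cos^2(pi / m) for m = 2, 3, 4; the matrix may be asymmetric because the double bond of
  \<open>F\<^sub>4\<^sup>(\<^sup>1\<^sup>)\<close> joins roots of different length. As the roots
  separate points, identities between words can be tested on root values.\<close>

locale realization = coxeter_words I m
  for I :: "nat set" and m :: "nat \<Rightarrow> nat \<Rightarrow> nat" +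
  fixes X :: "'x set" and st :: "nat \<Rightarrow> 'x \<Rightarrow> 'x"
    and root :: "nat \<Rightarrow> 'x \<Rightarrow> complex" and cartan :: "nat \<Rightarrow> nat \<Rightarrow> complex"
  assumes finite: "finite I"
    and step_closed: "i \<in> I \<Longrightarrow> x \<in> X \<Longrightarrow> st i x \<in> X"
    and reflection: "i \<in> I \<Longrightarrow> j \<in> I \<Longrightarrow> x \<in> X \<Longrightarrow> root j (st i x) = root j x - cartan i j * root i x"
    and cartan_diag: "i \<in> I \<Longrightarrow> cartan i i = 2"
    and cartan_off_diag: "i \<in> I \<Longrightarrow> j \<in> I \<Longrightarrow> i \<noteq> j \<Longrightarrow>
      (m i j, cartan i j, cartan j i) \<in> {(2, 0, 0), (3, -1, -1), (4, -1, -2), (4, -2, -1)}"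
    and separating: "x \<in> X \<Longrightarrow> y \<in> X \<Longrightarrow> (\<And>i. i \<in> I \<Longrightarrow> root i x = root i y) \<Longrightarrow> x = y"
begin

section \<open>The Coxeter relations in a realization\<close>

lemma fold_closed: "v \<in> lists I \<Longrightarrow> x \<in> X \<Longrightarrow> fold st v x \<in> X"
  by (induction v arbitrary: x) (auto intro: step_closed)

lemma fold_relator:
  assumes "i \<in> I" "j \<in> I" "x \<in> X"
  shows "fold st (relator m i j) x = x"
proof (rule separating)
  fix k assume k: "k \<in> I"
  show "root k (fold st (relator m i j) x) = root k x"
  proof (cases "i = j")
    case True
    then show ?thesis
      using assms k
      by (simp add: relator_def diag step_closed reflection cartan_diag)
  next
    case False
    \<comment> \<open>\<open>T\<close> is the product of the two reflections. It acts on the values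
      of \<open>root i\<close> and \<open>root j\<close> by a 2 by 2 matrix and changes any other
      root by a combination of these two, so \<open>T ^^ m i j\<close> can be expanded for each
      possible bond.\<close>
    define T where "T y = st j (st i y)" for y
    have T: "T y \<in> X" if "y \<in> X" for y
      using that assms by (simp add: T_def step_closed)
    have root_T: "root l (T y) = root l y - (cartan i l - cartan j l * cartan i j) * root i y
        - cartan j l * root j y" if "y \<in> X" "l \<in> I" for l y
      using that assms by (simp add: T_def step_closed reflection algebra_simps)
    have root_i_T: "root i (T y) = (cartan j i * cartan i j - 1) * root i y - cartan j i * root j y"
      and root_j_T: "root j (T y) = cartan i j * root i y - root j y" if "y \<in> X" for y
      using that assms by (simp_all add: root_T cartan_diag algebra_simps)
    have "fold st (concat (replicate n [i, j])) y = (T ^^ n) y" for n y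
      by (induction n arbitrary: y) (simp_all add: T_def funpow_Suc_right del: funpow.simps(2))
    then have "fold st (relator m i j) x = (T ^^ m i j) x"
      by (simp add: relator_def)
    moreover have "root k ((T ^^ m i j) x) = root k x"
    proof -
      have step: "root k (T y) = root k y - a * root i y - b * root j y"
        if "y \<in> X" "a = cartan i k - cartan j k * cartan i j" "b = cartan j k" for y a b
        using that k by (simp add: root_T)
      define a b where "a = cartan i k - cartan j k * cartan i j" and "b = cartan j k"
      note simps = T step[OF _ a_def b_def] root_i_T root_j_T assms(3) eval_nat_numeral algebra_simps
      consider "m i j = 2" "cartan i j = 0" "cartan j i = 0"
        | "m i j = 3" "cartan i j = -1" "cartan j i = -1"
        | "m i j = 4" "cartan i j = -1" "cartan j i = -2"
        | "m i j = 4" "cartan i j = -2" "cartan j i = -1"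
        using cartan_off_diag[OF assms(1,2) False] by auto
      then show ?thesis
        by cases (simp_all add: simps)
    qed
    ultimately show ?thesis by simp
  qed
qed (simp_all add: fold_closed assms)

lemma fold_cox_eq: "cox_eq I m v w \<Longrightarrow> x \<in> X \<Longrightarrow> fold st v x = fold st w x"
  by (induction arbitrary: x rule: cox_eq.induct) (auto simp: fold_relator fold_closed)

section \<open>Nonnegative combinations of simple roots and their signs\<close>

definition nonneg :: "('x \<Rightarrow> complex) \<Rightarrow> bool" where
  "nonneg f \<longleftrightarrow> (\<exists>c. (\<forall>i. 0 \<le> c i) \<and> (\<forall>x\<in>X. f x = (\<Sum>i\<in>I. complex_of_real (c i) * root i x)))"

lemma nonneg_cong: "nonneg f \<Longrightarrow> (\<And>x. x \<in> X \<Longrightarrow> f x = g x) \<Longrightarrow> nonneg g"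
  unfolding nonneg_def by auto

lemma nonneg_root: "s \<in> I \<Longrightarrow> nonneg (root s)"
  unfolding nonneg_def
  by (rule exI[of _ "\<lambda>i. if i = s then 1 else 0"])
    (simp add: finite if_distrib[of complex_of_real] if_distrib[of "\<lambda>c. c * _"] cong: if_cong)

lemma nonneg_combination:
  assumes "nonneg f" "nonneg g" "0 \<le> a" "0 \<le> b"
  shows "nonneg (\<lambda>x. of_real a * f x + of_real b * g x)"
proof -
  obtain c d where "\<forall>i. 0 \<le> c i" "\<forall>x\<in>X. f x = (\<Sum>i\<in>I. complex_of_real (c i) * root i x)"
    "\<forall>i. 0 \<le> d i" "\<forall>x\<in>X. g x = (\<Sum>i\<in>I. complex_of_real (d i) * root i x)"
    using assms(1,2) unfolding nonneg_def by blast
  then show ?thesis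
    unfolding nonneg_def using assms(3,4)
    by (intro exI[of _ "\<lambda>i. a * c i + b * d i"])
      (auto simp: sum_distrib_left sum.distrib algebra_simps)
qed

text \<open>The coefficients in \<open>nonneg\<close> are only known to exist, so signs are read off
  at points where every simple root is real and nonnegative.\<close>

lemma nonneg_real_part:
  assumes "nonneg f" "x \<in> X" "\<And>i. i \<in> I \<Longrightarrow> root i x \<in> \<real> \<and> 0 \<le> Re (root i x)"
  shows "0 \<le> Re (f x)"
proof -
  obtain c where "\<forall>i. 0 \<le> c i" "\<forall>x\<in>X. f x = (\<Sum>i\<in>I. complex_of_real (c i) * root i x)"
    using assms(1) unfolding nonneg_def by blast
  then show ?thesis
    using assms(2,3) by (auto intro!: sum_nonneg)
qed

text \<open>
  Write \<open>v = u x\<close> with lengths adding up, \<open>x\<close> in a dihedral subgroup \<open>\<langle>s, t\<rangle>\<close> and \<open>u\<close> as short as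
  possible. Then \<open>u(\<alpha>\<^sub>s)\<close> and \<open>u(\<alpha>\<^sub>t)\<close> are nonnegative by induction, and \<open>x(\<alpha>\<^sub>s)\<close> is a nonnegative
  combination of \<open>\<alpha>\<^sub>s\<close> and \<open>\<alpha>\<^sub>t\<close> because \<open>x s\<close> is reduced.
\<close>

theorem nonneg_root_of_ascent:
  assumes "v \<in> lists I" "s \<in> I" "len v < len (v @ [s])"
  shows "nonneg (\<lambda>x. root s (fold st v x))"
  using assms
proof (induction "len v" arbitrary: v s rule: less_induct)
  case less
  show ?case
  proof (cases "cox_eq I m v []")
    case True
    then show ?thesis
      using fold_cox_eq[OF True] by (intro nonneg_cong[OF nonneg_root[OF less.prems(2)]]) auto
  next
    case False
    then obtain t where t: "t \<in> I" "len (v @ [t]) < len v"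
      using descent_exists less.prems(1) by blast
    have "t \<noteq> s" using t less.prems by auto
    define Q where "Q k \<longleftrightarrow> (\<exists>u x. u \<in> lists I \<and> x \<in> lists {s, t} \<and> cox_eq I m v (u @ x)
      \<and> len u = k \<and> k + length x = len v)" for k
    have Qt: "Q (len (v @ [t]))"
      unfolding Q_def
      using t less.prems(1) len_snoc[OF less.prems(1) t(1)] append_square[OF less.prems(1) t(1)]
      by (intro exI[of _ "v @ [t]"] exI[of _ "[t]"]) (auto intro: cox_eq.sym)
    define k where "k = (LEAST k. Q k)"
    have "Q k" "k \<le> len (v @ [t])"
      using Qt unfolding k_def by (auto intro: LeastI Least_le)
    then obtain u x where u: "u \<in> lists I" and x: "x \<in> lists {s, t}"
      and vux: "cox_eq I m v (u @ x)" and k: "len u = k" "k + length x = len v"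
      unfolding Q_def by blast
    have less_u: "len u < len v" using k \<open>k \<le> len (v @ [t])\<close> t by simp
    have xI: "x \<in> lists I" using x t(1) less.prems(2) by (auto simp: in_lists_conv_set)
    \<comment> \<open>A descent \<open>r\<close> of \<open>u\<close> could be moved from
      \<open>u\<close> to the front of \<open>x\<close>, against the minimality of
      \<open>k\<close>.\<close>
    have ascent: "len u < len (u @ [r])" if "r \<in> {s, t}" for r
    proof (rule ccontr)
      assume "\<not> len u < len (u @ [r])"
      moreover have r: "r \<in> I" using that t(1) less.prems(2) by auto
      ultimately have lr: "len u = Suc (len (u @ [r]))" using len_snoc[OF u] by fastforce
      have "cox_eq I m (u @ x) ((u @ [r, r]) @ x)"
        using xI by (intro cox_eq_append cox_eq.refl cox_eq.sym[OF append_square[OF u r]])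
      then have "cox_eq I m v ((u @ [r]) @ r # x)"
        using cox_eq.trans[OF vux] by simp
      then have "Q (len (u @ [r]))"
        unfolding Q_def using u r x that lr k
        by (intro exI[of _ "u @ [r]"] exI[of _ "r # x"]) auto
      then have "k \<le> len (u @ [r])" unfolding k_def by (rule Least_le)
      then show False using lr k by simp
    qed
    have ps: "nonneg (\<lambda>x. root s (fold st u x))" and pt: "nonneg (\<lambda>x. root t (fold st u x))"
      using less.hyps[OF less_u u] ascent t(1) less.prems(2) by auto
    have vs: "cox_eq I m (v @ [s]) (u @ x @ [s])"
      using cox_eq_append[OF vux, of "[s]" "[s]"] less.prems(2) by (simp add: cox_eq.refl)
    \<comment> \<open>Since \<open>s\<close> is an ascent of \<open>v\<close>, lengths add up in
      \<open>u @ x @ [s]\<close>; hence no factor of \<open>x @ [s]\<close> has a shorter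
      representative.\<close>
    have irreducible: "length b \<le> length b'"
      if "x @ [s] = a @ b @ c" "cox_eq I m b b'" for a b b' c
    proof -
      have l: "a \<in> lists I" "c \<in> lists I" "b' \<in> lists I"
      proof -
        have "a @ b @ c \<in> lists I" using xI less.prems(2) that(1)[symmetric] by simp
        then show "a \<in> lists I" "c \<in> lists I" by auto
      qed (use cox_eq_in_lists[OF that(2)] in auto)
      have "cox_eq I m (u @ x @ [s]) (u @ a @ b' @ c)"
        unfolding that(1) using that(2) l u by (intro cox_eq_append cox_eq.refl) auto
      then have "cox_eq I m (v @ [s]) (u @ a @ b' @ c)"
        using vs by (rule_tac cox_eq.trans)
      then have "len (v @ [s]) \<le> len u + length (a @ b' @ c)"
        using len_cong len_append_le[of u "a @ b' @ c"] u l by simp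
      moreover have "length (x @ [s]) = length (a @ b @ c)" using that(1) by simp
      ultimately show ?thesis using k less.prems(3) by simp
    qed
    have rel: "cox_eq I m (relator m s t) []"
      using cox_eq.relation[of "[]" I "[]" s t m] t(1) less.prems(2) by simp
    note braid = eq_rev_of_append_eq_Nil
    \<comment> \<open>The word \<open>x @ [s]\<close> alternates and has at most
      \<open>m s t\<close> letters: squares cancel, and a longer alternating word is shortened by
      the braid relation.\<close>
    have x_cases: "x = [] \<or> x = [t] \<or> x = [s, t] \<and> m s t \<noteq> 2 \<or> x = [t, s, t] \<and> m s t = 4"
    proof -
      have sq: "cox_eq I m [s, s] []" "cox_eq I m [t, t] []"
        using square t(1) less.prems(2) by auto
      \<comment> \<open>Reversal lets the case analysis read \<open>x\<close> from its right end,
        next to the final \<open>s\<close>.\<close>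
      obtain y where y: "x = rev y" by (metis rev_rev_ident)
      have ylists: "y \<in> lists {s, t}" using x y by (simp add: in_lists_conv_set)
      have m: "m s t \<in> {2, 3, 4}"
        using cartan_off_diag[OF less.prems(2) t(1)] \<open>t \<noteq> s\<close> by auto
      have n1: False if "y = s # z" for z
        using irreducible[of "rev z" "[s, s]" "[]" "[]"] that y sq by simp
      have n2: False if "y = t # t # z" for z
        using irreducible[of "rev z" "[t, t]" "[s]" "[]"] that y sq by simp
      have n3: False if "y = t # s # s # z" for z
        using irreducible[of "rev z" "[s, s]" "[t, s]" "[]"] that y sq by simp
      have n4: False if "y = t # s # t # t # z" for z
        using irreducible[of "rev z" "[t, t]" "[s, t, s]" "[]"] that y sq by simp
      have m2: False if "y = t # s # z" "m s t = 2" for z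
        using irreducible[of "rev z" "[s, t, s]" "[]" "[t]"] that y rel
          braid[of "[s, t, s]" "[t]"]
        by (simp add: relator_def numeral_eq_Suc)
      have m3: False if "y = t # s # t # z" "m s t = 3" for z
        using irreducible[of "rev z" "[t, s, t, s]" "[]" "[s, t]"] that y rel
          braid[of "[s, t]" "[s, t, s, t]"]
        by (auto simp: relator_def numeral_eq_Suc intro: cox_eq.sym)
      have m4: False if "y = t # s # t # s # z" "m s t = 4" for z
        using irreducible[of "rev z" "[s, t, s, t, s]" "[]" "[t, s, t]"] that y rel
          braid[of "[s, t, s, t, s]" "[t, s, t]"]
        by (simp add: relator_def numeral_eq_Suc)
      show ?thesis
      proof (cases y)
        case Nil
        then show ?thesis using y by simp
      next
        case (Cons a z)
        then have a: "a = t" using ylists n1 by auto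
        show ?thesis
        proof (cases z)
          case Nil
          then show ?thesis using y Cons a by simp
        next
          case (Cons b z')
          then have b: "b = s" using ylists n2 \<open>y = a # z\<close> a by auto
          have m': "m s t \<noteq> 2" using m2 Cons \<open>y = a # z\<close> a b by auto
          show ?thesis
          proof (cases z')
            case Nil
            then show ?thesis using y Cons \<open>y = a # z\<close> a b m' by simp
          next
            case (Cons c z'')
            then have y': "y = t # s # c # z''"
              using \<open>z = b # z'\<close> \<open>y = a # z\<close> a b by simp
            then have c: "c = t" using ylists n3 by auto
            have m'': "m s t = 4" using m m' m3 y' c by auto
            have "z'' = []"
              using n4 m4 m'' y' c ylists by (cases z'') auto
            then show ?thesis using y y' c m'' by simp
          qed
        qed
      qed
    qed
    have fold_v: "fold st v z = fold st x (fold st u z)" if "z \<in> X" for z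
      using fold_cox_eq[OF vux that] by simp
    have comb: ?thesis if "0 \<le> a" "0 \<le> b"
      "\<And>z. z \<in> X \<Longrightarrow> root s (fold st x z) = of_real a * root s z + of_real b * root t z" for a b
      using nonneg_combination[OF ps pt that(1,2)]
      by (rule nonneg_cong) (use that(3) fold_v fold_closed[OF u] in auto)
    have C: "(m s t, cartan s t, cartan t s) \<in> {(2, 0, 0), (3, -1, -1), (4, -1, -2), (4, -2, -1)}"
      using cartan_off_diag[OF less.prems(2) t(1)] \<open>t \<noteq> s\<close> by simp
    have st: "s \<in> I" "t \<in> I" using less.prems t by auto
    note simps = st step_closed reflection cartan_diag algebra_simps
    from x_cases show ?thesis
    proof (elim disjE conjE)
      assume "x = []"
      then show ?thesis by (intro comb[of 1 0]) simp_all
    next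
      assume "x = [t]"
      then show ?thesis using C
        by (intro comb[of 1 "- Re (cartan t s)"]) (auto simp: simps)
    next
      assume "x = [s, t]" "m s t \<noteq> 2"
      then show ?thesis using C
        by (intro comb[of "Re (cartan t s * cartan s t) - 1" "- Re (cartan t s)"]) (auto simp: simps)
    next
      \<comment> \<open>For \<open>m s t = 4\<close> the reflection \<open>t s t\<close> commutes
        with \<open>s\<close> and fixes \<open>\<alpha>\<^sub>s\<close>, whence the coefficients 1
        and 0.\<close>
      assume "x = [t, s, t]" "m s t = 4"
      then show ?thesis using C
        by (intro comb[of 1 0]) (auto simp: simps)
    qed
  qed
qed

text \<open>Here \<open>s\<close> is an ascent of \<open>v @ [s]\<close>, and the reflection
  \<open>s\<close> negates its own root.\<close>

lemma nonpos_root_of_descent: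
  assumes "v \<in> lists I" "s \<in> I" "len (v @ [s]) < len v"
  shows "nonneg (\<lambda>x. - root s (fold st v x))"
proof -
  have "len (v @ [s, s]) = len v"
    by (intro len_cong append_square assms)
  then have "nonneg (\<lambda>x. root s (fold st (v @ [s]) x))"
    using assms by (intro nonneg_root_of_ascent) auto
  then show ?thesis
    by (rule nonneg_cong)
      (use assms fold_closed in \<open>simp add: reflection cartan_diag\<close>)
qed

lemma descent_of_not_nonneg:
  assumes "v \<in> lists I" "s \<in> I" "\<not> nonneg (\<lambda>x. root s (fold st v x))"
  shows "len (v @ [s]) < len v"
  using nonneg_root_of_ascent assms len_snoc[OF assms(1,2)] by fastforce

text \<open>The point \<open>p\<close> lies inside the fundamental chamber. A nontrivial
  \<open>v\<close> has a descent \<open>s\<close>, and then the root of \<open>s\<close> would be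
  nonpositive at the image of \<open>p\<close>; but \<open>v\<close> fixes \<open>p\<close>, where
  the root is 1.\<close>

lemma faithful:
  assumes "p \<in> X" "\<And>i. i \<in> I \<Longrightarrow> root i p = 1"
    and "v \<in> lists I" "\<And>x. x \<in> X \<Longrightarrow> fold st v x = x"
  shows "cox_eq I m v []"
proof (rule ccontr)
  assume "\<not> cox_eq I m v []"
  then obtain s where s: "s \<in> I" "len (v @ [s]) < len v"
    using descent_exists assms(3) by blast
  have "0 \<le> Re (- root s (fold st v p))"
    using nonneg_real_part[OF nonpos_root_of_descent[OF assms(3) s] assms(1)] assms(2) by simp
  then show False using assms s by simp
qed

end


section \<open>The root system of type \<open>E\<^sub>8\<^sup>(\<^sup>1\<^sup>)\<close> on the parameters\<close>

lemma exhaust_8: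
  fixes k :: 8
  shows "k = 1 \<or> k = 2 \<or> k = 3 \<or> k = 4 \<or> k = 5 \<or> k = 6 \<or> k = 7 \<or> k = 8"
proof (induct k)
  case (of_int z)
  then have "z = 0 \<or> z = 1 \<or> z = 2 \<or> z = 3 \<or> z = 4 \<or> z = 5 \<or> z = 6 \<or> z = 7" by fastforce
  then show ?case by auto
qed

lemma forall_8: "(\<forall>k::8. P k) \<longleftrightarrow> P 1 \<and> P 2 \<and> P 3 \<and> P 4 \<and> P 5 \<and> P 6 \<and> P 7 \<and> P 8"
  by (metis exhaust_8)

lemma param_eq_iff:
  fixes p q :: param
  shows "p = q \<longleftrightarrow> (\<forall>k. fst p $ k = fst q $ k) \<and> snd p = snd q"
  by (auto simp: prod_eq_iff vec_eq_iff)

lemma swap_u_sel [simp]: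
  "fst (swap_u i j p) $ k = (if k = i then fst p $ j else if k = j then fst p $ i else fst p $ k)"
  "snd (swap_u i j p) = snd p"
  by (simp_all add: swap_u_def split: prod.splits)

lemma w2_param_sel [simp]:
  "fst (w2_param p) $ k = (if k = 1 \<or> k = 2
    then fst p $ k - 3 / 4 * (2 * snd p + fst p $ 1 + fst p $ 2)
    else fst p $ k + 1 / 4 * (2 * snd p + fst p $ 1 + fst p $ 2))"
  "snd (w2_param p) = snd p - 1 / 4 * (2 * snd p + fst p $ 1 + fst p $ 2)"
  by (simp_all add: w2_param_def Let_def split: prod.splits)

text \<open>The factor -4 is the scaling for which both Cartan entries between nodes 1 and 2 are -1.
  Node 8 branches off from node 3, and node 0 is the end of the long arm, next to node 7.\<close>

definition e8_root :: "nat \<Rightarrow> param \<Rightarrow> complex" where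
  "e8_root i p = (case p of (u, b) \<Rightarrow>
    [u $ 8 - u $ 7, - 4 * b, 2 * b + u $ 1 + u $ 2, u $ 3 - u $ 2, u $ 4 - u $ 3,
     u $ 5 - u $ 4, u $ 6 - u $ 5, u $ 7 - u $ 6, u $ 2 - u $ 1] ! i)"

lemma e8_root_simps:
  "e8_root 0 p = fst p $ 8 - fst p $ 7"
  "e8_root 1 p = - 4 * snd p"
  "e8_root (Suc 0) p = - 4 * snd p"
  "e8_root 2 p = 2 * snd p + fst p $ 1 + fst p $ 2"
  "e8_root 3 p = fst p $ 3 - fst p $ 2"
  "e8_root 4 p = fst p $ 4 - fst p $ 3"
  "e8_root 5 p = fst p $ 5 - fst p $ 4"
  "e8_root 6 p = fst p $ 6 - fst p $ 5"
  "e8_root 7 p = fst p $ 7 - fst p $ 6"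
  "e8_root 8 p = fst p $ 2 - fst p $ 1"
  by (simp_all add: e8_root_def split: prod.splits)

definition e8_cartan :: "nat \<Rightarrow> nat \<Rightarrow> complex" where
  "e8_cartan i j = (if i = j then 2 else if e8_matrix i j = 3 then -1 else 0)"

lemma le_8_cases: "i \<le> 8 \<Longrightarrow> i \<in> {0, 1, 2, 3, 4, 5, 6, 7, 8::nat}"
  by auto

text \<open>The nine roots form a linear coordinate system; the inversion is triangular, each line
  using coordinates found before it.\<close>

lemma coords_from_e8_roots:
  "snd p = - e8_root 1 p / 4"
  "fst p $ 1 = (e8_root 2 p + e8_root 1 p / 2 - e8_root 8 p) / 2"
  "fst p $ 2 = fst p $ 1 + e8_root 8 p"
  "fst p $ 3 = fst p $ 2 + e8_root 3 p"
  "fst p $ 4 = fst p $ 3 + e8_root 4 p"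
  "fst p $ 5 = fst p $ 4 + e8_root 5 p"
  "fst p $ 6 = fst p $ 5 + e8_root 6 p"
  "fst p $ 7 = fst p $ 6 + e8_root 7 p"
  "fst p $ 8 = fst p $ 7 + e8_root 0 p"
  by (simp_all add: e8_root_simps)

lemma e8_matrix_alt: "e8_matrix i j =
    (if i = j then 1
     else if (i, j) \<in> {(1,2), (2,3), (3,4), (4,5), (5,6), (6,7), (0,7), (3,8)}
       \<or> (j, i) \<in> {(1,2), (2,3), (3,4), (4,5), (5,6), (6,7), (0,7), (3,8)} then 3
     else 2)"
  by (auto simp: e8_matrix_def doubleton_eq_iff)

lemma param_step_simps:
  "param_step 0 = swap_u 7 8"
  "param_step 1 = (\<lambda>p. (fst p, - snd p))"
  "param_step (Suc 0) = (\<lambda>p. (fst p, - snd p))"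
  "param_step 2 = w2_param"
  "param_step 3 = swap_u 2 3"
  "param_step 4 = swap_u 3 4"
  "param_step 5 = swap_u 4 5"
  "param_step 6 = swap_u 5 6"
  "param_step 7 = swap_u 6 7"
  "param_step 8 = swap_u 1 2"
  by (simp_all add: param_step_def fun_eq_iff)

lemma e8_root_param_step:
  assumes "i \<le> 8" "j \<le> 8"
  shows "e8_root j (param_step i p) = e8_root j p - e8_cartan i j * e8_root i p"
proof -
  have j: "j \<in> {0, 1, 2, 3, 4, 5, 6, 7, 8::nat}"
    using assms le_8_cases by blast
  note simps = e8_root_simps param_step_simps e8_cartan_def e8_matrix_alt
  have "i \<in> {0, 1, 2, 3, 4, 5, 6, 7, 8::nat}"
    using assms le_8_cases by blast
  then consider "i = 0" | "i = 1" | "i = 2" | "i = 3" | "i = 4" | "i = 5" | "i = 6" | "i = 7" | "i = 8"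
    by blast
  then show ?thesis
    using j by cases (safe, simp_all add: simps field_simps)
qed

interpretation E8: realization "{..8}" e8_matrix UNIV param_step e8_root e8_cartan
proof
  fix i j :: nat assume "i \<in> {..8}" "j \<in> {..8}"
  then show "i \<noteq> j \<Longrightarrow> (e8_matrix i j, e8_cartan i j, e8_cartan j i)
      \<in> {(2, 0, 0), (3, - 1, - 1), (4, - 1, - 2), (4, - 2, - 1)}"
    by (auto simp: e8_cartan_def e8_matrix_def insert_commute)
next
  fix p q :: param assume "\<And>i. i \<in> {..8} \<Longrightarrow> e8_root i p = e8_root i q"
  then have "\<forall>i\<le>8. e8_root i p = e8_root i q" by simp
  then show "p = q"
    unfolding param_eq_iff forall_8 by (simp add: coords_from_e8_roots)
qed (simp_all add: e8_matrix_def e8_cartan_def e8_root_param_step)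

section \<open>The subspace\<close>

lemma special_iff:
  "p \<in> special \<longleftrightarrow> fst p $ 1 = fst p $ 2 \<and> fst p $ 3 = fst p $ 4 \<and>
    fst p $ 5 = fst p $ 6 \<and> fst p $ 7 = fst p $ 8"
  by (simp add: special_def coord_u_def)

text \<open>These four generators are the reflections whose roots vanish on the subspace.\<close>

lemma fold_id_special:
  assumes "v \<in> lists {0, 4, 6, 8}" "p \<in> special"
  shows "fold param_step v p = p"
proof -
  have "param_step i p = p" if "i \<in> {0, 4, 6, 8}" for i
    using that assms(2) by (auto simp: param_step_def param_eq_iff forall_8 special_iff)
  with assms(1) show ?thesis
    by (induction v) auto
qed

section \<open>Linear maps preserving the subspace\<close>

lemma linear_param_step:
  assumes "i \<le> 8"
  shows "linear (param_step i)"
proof -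
  have "linear (swap_u j k)" for j k
    by (rule linearI) (simp_all add: param_eq_iff)
  moreover have "linear w2_param"
    by (rule linearI) (simp_all add: param_eq_iff scaleR_conv_of_real[where 'a = complex] algebra_simps)
  moreover have "linear (\<lambda>p::param. (fst p, - snd p))"
    by (rule linearI) (simp_all add: param_eq_iff)
  ultimately show ?thesis
    using le_8_cases[OF assms] by (safe; simp add: param_step_simps)
qed

lemma linear_fold_param_step: "v \<in> lists {..8} \<Longrightarrow> linear (fold param_step v)"
proof (induction v)
  case (Cons i v)
  then show ?case
    using linear_compose[OF linear_param_step[of i]] by (simp add: o_def)
qed (simp add: linear_id)

lemma subspace_special: "subspace special"
  by (simp add: subspace_def special_iff)

definition preserving :: "nat list \<Rightarrow> bool" where
  "preserving v \<longleftrightarrow> v \<in> lists {..8} \<and> (\<forall>p\<in>special. fold param_step v p \<in> special)"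

lemma fold_rev_cancel:
  assumes "v \<in> lists {..8}"
  shows "fold param_step v (fold param_step (rev v) p) = p"
    and "fold param_step (rev v) (fold param_step v p) = p"
  using E8.fold_cox_eq[OF E8.rev_append[OF assms], of p]
    E8.fold_cox_eq[OF E8.append_rev[OF assms], of p] by simp_all

text \<open>Being in \<open>Omega\<close> only asks that the subspace be mapped into itself. An
  injective linear map of a finite-dimensional space into itself is onto, so the inverse preserves
  the subspace too.\<close>

lemma preserving_rev:
  assumes "preserving v"
  shows "preserving (rev v)"
proof -
  have v: "v \<in> lists {..8}" using assms by (simp add: preserving_def)
  let ?f = "fold param_step v"
  have "inj ?f"
    using fold_rev_cancel(2)[OF v] by (metis injI)
  then have "dim (?f ` special) = dim special"
    by (intro dim_image_eq linear_fold_param_step v) (auto intro: inj_on_subset)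
  moreover have "?f ` special \<subseteq> special" using assms by (auto simp: preserving_def)
  ultimately have "?f ` special = special"
    by (intro subspace_dim_equal subspace_special linear_subspace_image linear_fold_param_step v) auto
  then have "fold param_step (rev v) p \<in> special" if "p \<in> special" for p
    using that fold_rev_cancel(2)[OF v] by (metis imageE)
  then show ?thesis using v by (simp add: preserving_def in_lists_conv_set)
qed

lemma preserving_append: "preserving v \<Longrightarrow> preserving w \<Longrightarrow> preserving (v @ w)"
  by (simp add: preserving_def)

text \<open>The coordinates solve the equations that the roots 0, 4, 6, 8 be 0 and the other five be
  1. This is an interior point of the face of the fundamental chamber lying in the subspace.\<close>

definition base_point :: param where
  "base_point = (\<chi> k. if k = 1 \<or> k = 2 then 3/4 else if k = 3 \<or> k = 4 then 7/4
     else if k = 5 \<or> k = 6 then 11/4 else 15/4, - 1/4)"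

lemma base_point_special: "base_point \<in> special"
  by (simp add: base_point_def special_iff)

lemma e8_root_base_point:
  assumes "i \<le> 8"
  shows "e8_root i base_point = (if i \<in> {0, 4, 6, 8} then 0 else 1)"
  using le_8_cases[OF assms] by (auto simp: e8_root_simps base_point_def)

lemma e8_root_special: "p \<in> special \<Longrightarrow> i \<in> {0, 4, 6, 8} \<Longrightarrow> e8_root i p = 0"
  by (auto simp: e8_root_simps special_iff)

lemma nonneg_at_base_point: "E8.nonneg f \<Longrightarrow> 0 \<le> Re (f base_point)"
  by (rule E8.nonneg_real_part) (auto simp: e8_root_base_point)


text \<open>At \<open>base_point\<close> all terms of the combination are nonnegative, so the five
  roots that do not vanish there have coefficient 0; the other four vanish on the whole
  subspace.\<close>

lemma nonneg_vanishing:
  assumes "E8.nonneg f" "Re (f base_point) \<le> 0" "p \<in> special"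
  shows "f p = 0"
proof -
  obtain c where c: "\<forall>i. 0 \<le> c i" "\<forall>x. f x = (\<Sum>i\<le>8. complex_of_real (c i) * e8_root i x)"
    using assms(1) unfolding E8.nonneg_def by auto
  have "(\<Sum>i\<le>8. c i * (if i \<in> {0, 4, 6, 8} then 0 else 1)) = Re (f base_point)"
    unfolding c(2)[rule_format] Re_sum by (intro sum.cong) (auto simp: e8_root_base_point)
  then have "(\<Sum>i\<le>8. c i * (if i \<in> {0, 4, 6, 8} then 0 else 1)) \<le> 0"
    using assms(2) by simp
  moreover have "0 \<le> c i * (if i \<in> {0, 4, 6, 8} then 0 else 1)" for i
    using c(1) by simp
  ultimately have "\<forall>i\<in>{..8}. c i * (if i \<in> {0, 4, 6, 8} then 0 else 1) = 0"
    by (subst sum_nonneg_eq_0_iff[symmetric]) (auto intro!: antisym sum_nonneg)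
  then have "c i = 0 \<or> e8_root i p = 0" if "i \<le> 8" for i
    using that e8_root_special[OF assms(3), of i] by (cases "i \<in> {0, 4, 6, 8}") auto
  then show ?thesis
    unfolding c(2)[rule_format] by (intro sum.neutral) auto
qed

text \<open>
  Modulo the roots vanishing on the subspace, \<open>y(\<alpha>\<^sub>t)\<close> equals \<open>\<alpha>\<^sub>s\<close>; since \<open>w\<close> permutes the
  functions vanishing on the subspace, the signs of \<open>w(\<alpha>\<^sub>s)\<close> and \<open>w(y(\<alpha>\<^sub>t))\<close> agree.
\<close>

lemma descent_propagates:
  assumes "preserving w" "s \<le> 8" "s \<notin> {0, 4, 6, 8}" "E8.len (w @ [s]) < E8.len w"
    and "y \<in> lists {..8}" "t \<le> 8"
    and root: "\<And>p. p \<in> special \<Longrightarrow> e8_root t (fold param_step y p) = e8_root s p"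
  shows "E8.len (w @ y @ [t]) < E8.len (w @ y)"
proof (rule ccontr)
  assume neg: "\<not> ?thesis"
  have w: "w \<in> lists {..8}" and special: "\<And>p. p \<in> special \<Longrightarrow> fold param_step w p \<in> special"
    using assms(1) by (auto simp: preserving_def)
  have "E8.nonneg (\<lambda>x. e8_root t (fold param_step (w @ y) x))"
    using neg E8.descent_of_not_nonneg[of "w @ y" t] w assms(5,6) by auto
  then have "0 \<le> Re (e8_root t (fold param_step (w @ y) base_point))"
    by (rule nonneg_at_base_point)
  also have "\<dots> = Re (e8_root s (fold param_step w base_point))"
    using root special base_point_special by simp
  finally have "Re (- e8_root s (fold param_step w base_point)) \<le> 0" by simp
  moreover have nonneg: "E8.nonneg (\<lambda>x. - e8_root s (fold param_step w x))"
    using E8.nonpos_root_of_descent[OF w _ assms(4)] assms(2) by simp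
  \<comment> \<open>This is the preimage of \<open>base_point\<close> under \<open>w\<close>: a
    function \<open>w(\<alpha>\<^sub>s)\<close> vanishing on the subspace would vanish here, but its
    value is that of \<open>\<alpha>\<^sub>s\<close> at \<open>base_point\<close>, which is
    1.\<close>
  moreover have "fold param_step (rev w) base_point \<in> special"
    using preserving_rev[OF assms(1)] base_point_special by (simp add: preserving_def)
  ultimately have "- e8_root s (fold param_step w (fold param_step (rev w) base_point)) = 0"
    using nonneg_vanishing[OF nonneg] by blast
  then show False
    using fold_rev_cancel(1)[OF w] assms(2,3) by (simp add: e8_root_base_point)
qed

text \<open>As \<open>v\<close> fixes \<open>base_point\<close>, where the other five roots are 1,
  the sign criterion leaves only 0, 4, 6, 8 as descents. These letters fix the subspace and are
  stripped one after another.\<close>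

lemma stabilizer:
  assumes "v \<in> lists {..8}" "\<And>p. p \<in> special \<Longrightarrow> fold param_step v p = p"
  shows "\<exists>w\<in>lists {0, 4, 6, 8}. cox_eq {..8} e8_matrix v w"
  using assms
proof (induction "E8.len v" arbitrary: v rule: less_induct)
  case less
  show ?case
  proof (cases "cox_eq {..8} e8_matrix v []")
    case False
    then obtain s where s: "s \<le> 8" "E8.len (v @ [s]) < E8.len v"
      using E8.descent_exists[OF less.prems(1)] by auto
    have J: "s \<in> {0, 4, 6, 8}"
    proof (rule ccontr)
      assume "s \<notin> {0, 4, 6, 8}"
      then show False
        using nonneg_at_base_point[OF E8.nonpos_root_of_descent[OF less.prems(1) _ s(2)]] s(1)
          less.prems(2)[OF base_point_special] e8_root_base_point[OF s(1)] by simp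
    qed
    have vs: "v @ [s] \<in> lists {..8}" using less.prems(1) s(1) by simp
    have "fold param_step (v @ [s]) p = p" if "p \<in> special" for p
      using less.prems(2)[OF that] fold_id_special[of "[s]" p] J that by simp
    from less.hyps[OF s(2) vs this] obtain w
      where w: "w \<in> lists {0, 4, 6, 8}" "cox_eq {..8} e8_matrix (v @ [s]) w" by blast
    have "cox_eq {..8} e8_matrix v (v @ [s, s])"
      by (rule cox_eq.sym[OF E8.append_square]) (use less.prems(1) s(1) in auto)
    moreover have "cox_eq {..8} e8_matrix ((v @ [s]) @ [s]) (w @ [s])"
      by (rule cox_eq_append[OF w(2) cox_eq.refl]) (use s(1) in simp)
    ultimately have "cox_eq {..8} e8_matrix v (w @ [s])"
      using cox_eq.trans by fastforce
    then show ?thesis using w(1) J by (intro bexI[of _ "w @ [s]"]) auto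
  qed (auto intro!: bexI[of _ "[]"])
qed


section \<open>The root system of type \<open>F\<^sub>4\<^sup>(\<^sup>1\<^sup>)\<close> on the subspace\<close>

text \<open>The last three words are conjugates of products of two commuting generators. For
  example, \<open>[3, 4, 8, 3]\<close> is the product of the reflections in the orthogonal roots
  \<open>\<alpha>\<^sub>3 + \<alpha>\<^sub>4\<close> and
  \<open>\<alpha>\<^sub>3 + \<alpha>\<^sub>8\<close>; both restrict to
  \<open>\<alpha>\<^sub>3\<close> on the subspace, where the product acts as one reflection.\<close>

definition f4_word :: "nat \<Rightarrow> nat list" where
  "f4_word k = [[1], [2], [3, 4, 8, 3], [5, 4, 6, 5], [7, 6, 0, 7]] ! k"

definition f4_index :: "nat \<Rightarrow> nat" where
  "f4_index k = [1, 2, 3, 5, 7] ! k"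

abbreviation f4_step :: "nat \<Rightarrow> param \<Rightarrow> param" where
  "f4_step k \<equiv> fold param_step (f4_word k)"

definition f4_root :: "nat \<Rightarrow> param \<Rightarrow> complex" where
  "f4_root k = e8_root (f4_index k)"

text \<open>The entry -2 says that \<open>r\<^sub>1\<close> adds \<open>\<alpha>\<^sub>3\<close>
  twice to \<open>\<alpha>\<^sub>2\<close>, once for each of the two orthogonal roots behind
  \<open>r\<^sub>1\<close>.\<close>

definition f4_cartan :: "nat \<Rightarrow> nat \<Rightarrow> complex" where
  "f4_cartan i j = (if i = j then 2 else if (i, j) = (2, 1) then -2
     else if f4_matrix i j = 2 then 0 else -1)"

lemma f4_cartan_off_diag:
  assumes "i \<noteq> j"
  shows "(f4_matrix i j, f4_cartan i j, f4_cartan j i)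
    \<in> {(2, 0, 0), (3, - 1, - 1), (4, - 1, - 2), (4, - 2, - 1)}"
proof -
  have sym: "f4_matrix j i = f4_matrix i j"
    by (simp add: f4_matrix_def insert_commute)
  have four: "f4_matrix 1 2 = 4" "f4_matrix 2 1 = 4"
    by (simp_all add: f4_matrix_def doubleton_eq_iff)
  have "f4_matrix i j = 2 \<or> f4_matrix i j = 3 \<or> (i, j) = (1, 2) \<or> (i, j) = (2, 1)"
    using assms by (simp add: f4_matrix_def doubleton_eq_iff)
  then consider "f4_matrix i j \<in> {2, 3}" "(i, j) \<noteq> (2, 1)" "(j, i) \<noteq> (2, 1)"
    | "(i, j) = (1, 2)" | "(i, j) = (2, 1)"
    using four by fastforce
  then show ?thesis
    by cases (use assms sym four in \<open>auto simp: f4_cartan_def\<close>)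
qed

lemma le_4_cases: "i \<le> 4 \<Longrightarrow> i \<in> {0, 1, 2, 3, 4::nat}"
  by auto

lemma special_iff_roots: "p \<in> special \<longleftrightarrow> (\<forall>i\<in>{0, 4, 6, 8}. e8_root i p = 0)"
  by (auto simp: special_iff e8_root_simps)

lemma e8_roots_special [simp]:
  assumes "p \<in> special"
  shows "e8_root 0 p = 0" "e8_root 4 p = 0" "e8_root 6 p = 0" "e8_root 8 p = 0"
  using e8_root_special[OF assms] by simp_all

lemmas e8_simps = e8_root_param_step e8_cartan_def e8_matrix_alt

lemma f4_step_special:
  assumes "k \<le> 4" "p \<in> special"
  shows "f4_step k p \<in> special"
  using le_4_cases[OF assms(1)] assms(2) unfolding special_iff_roots
  by (safe; simp add: f4_word_def e8_simps)

lemma f4_root_f4_step: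
  assumes "i \<le> 4" "j \<le> 4" "p \<in> special"
  shows "f4_root j (f4_step i p) = f4_root j p - f4_cartan i j * f4_root i p"
proof -
  have "i \<in> {0, 1, 2, 3, 4}" "j \<in> {0, 1, 2, 3, 4}"
    using assms le_4_cases by blast+
  then show ?thesis
    using assms(3)[unfolded special_iff]
    by (safe; simp add: f4_word_def f4_index_def f4_root_def f4_cartan_def f4_matrix_def
        e8_root_simps param_step_simps doubleton_eq_iff; simp add: field_simps)
qed

text \<open>The subspace is again a realization, which yields both the relations of the five
  generators on it and the sign criterion for them. Points are separated because the other four
  roots vanish there.\<close>

interpretation F4: realization "{..4}" f4_matrix special f4_step f4_root f4_cartan
proof
  fix p q :: param
  assume pq: "p \<in> special" "q \<in> special" and eq: "\<And>i. i \<in> {..4} \<Longrightarrow> f4_root i p = f4_root i q"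
  have "e8_root i p = e8_root i q" if "i \<in> {1, 2, 3, 5, 7}" for i
    using that eq[of 0] eq[of 1] eq[of 2] eq[of 3] eq[of 4]
    by (auto simp: f4_root_def f4_index_def)
  then show "p = q"
    using pq unfolding param_eq_iff forall_8 by (simp add: coords_from_e8_roots)
next
  fix i j :: nat assume "i \<noteq> j"
  then show "(f4_matrix i j, f4_cartan i j, f4_cartan j i)
      \<in> {(2, 0, 0), (3, - 1, - 1), (4, - 1, - 2), (4, - 2, - 1)}"
    by (rule f4_cartan_off_diag)
qed (simp_all add: f4_step_special f4_root_f4_step f4_matrix_def[of i i for i]
  f4_cartan_def[of i i for i])

section \<open>Words in the five generators\<close>

abbreviation f4_subst :: "nat list \<Rightarrow> nat list" where
  "f4_subst u \<equiv> concat (map f4_word u)"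

lemma fold_f4_subst: "fold param_step (f4_subst u) p = fold f4_step u p"
  by (induction u arbitrary: p) auto

lemma f4_word_in_lists: "k \<le> 4 \<Longrightarrow> f4_word k \<in> lists {..8}"
  by (drule le_4_cases) (auto simp: f4_word_def)

lemma f4_subst_in_lists: "u \<in> lists {..4} \<Longrightarrow> f4_subst u \<in> lists {..8}"
  by (induction u) (auto simp: f4_word_in_lists)

lemma preserving_f4_subst: "u \<in> lists {..4} \<Longrightarrow> preserving (f4_subst u)"
  by (simp add: preserving_def f4_subst_in_lists fold_f4_subst F4.fold_closed)

lemma preserving_f4_word: "k \<le> 4 \<Longrightarrow> preserving (f4_word k)"
  using preserving_f4_subst[of "[k]"] by simp

text \<open>The letters \<open>a, b, c, a\<close> are appended one by one. Pulled back along the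
  prefix already appended, the root of each further letter restricts to that of \<open>a\<close> on
  the subspace, so by \<open>descent_propagates\<close> this letter shortens the word as
  well.\<close>

lemma f4_word_descent:
  assumes "preserving w" "k \<le> 4" "E8.len (w @ [f4_index k]) < E8.len w"
  shows "E8.len (w @ f4_word k) < E8.len w"
proof -
  let ?s = "f4_index k"
  note step = descent_propagates[OF assms(1) _ _ assms(3)]
  have s: "?s \<le> 8" "?s \<notin> {0, 4, 6, 8}"
    using le_4_cases[OF assms(2)] by (auto simp: f4_index_def)
  have conj: "E8.len (w @ [a, b, c, a]) < E8.len w"
    if "?s = a" "(a, b, c) \<in> {(3, 4, 8), (5, 4, 6), (7, 6, 0)}" for a b c
  proof -
    have "E8.len (w @ [a, b]) < E8.len (w @ [a])"
      using step[OF s, of "[a]" b] that by (auto simp: e8_simps)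
    moreover have "E8.len (w @ [a, b, c]) < E8.len (w @ [a, b])"
      using step[OF s, of "[a, b]" c] that by (auto simp: e8_simps)
    moreover have "E8.len (w @ [a, b, c, a]) < E8.len (w @ [a, b, c])"
      using step[OF s, of "[a, b, c]" a] that by (auto simp: e8_simps)
    ultimately show ?thesis using assms(3) that(1) by simp
  qed
  from le_4_cases[OF assms(2)] show ?thesis
    using conj assms(3) by (auto simp: f4_word_def f4_index_def)
qed

text \<open>Induction on the length: a descent among 0, 4, 6, 8 is removed without changing the map
  on the subspace, and for any other descent the corresponding \<open>f4_word\<close> shortens the
  word.\<close>

lemma preserving_f4:
  assumes "preserving w"
  obtains u where "u \<in> lists {..4}" "\<And>p. p \<in> special \<Longrightarrow> fold param_step w p = fold f4_step u p"
proof -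
  have "\<exists>u\<in>lists {..4}. \<forall>p\<in>special. fold param_step w p = fold f4_step u p"
    using assms
  proof (induction "E8.len w" arbitrary: w rule: less_induct)
    case less
    have w: "w \<in> lists {..8}" and special: "\<And>p. p \<in> special \<Longrightarrow> fold param_step w p \<in> special"
      using less.prems by (auto simp: preserving_def)
    show ?case
    proof (cases "cox_eq {..8} e8_matrix w []")
      case True
      then show ?thesis
        using E8.fold_cox_eq[OF True] by (intro bexI[of _ "[]"]) auto
    next
      case False
      then obtain s where s: "s \<le> 8" "E8.len (w @ [s]) < E8.len w"
        using E8.descent_exists[OF w] by auto
      show ?thesis
      proof (cases "s \<in> {0, 4, 6, 8}")
        case True
        have fixed: "param_step s p = p" if "p \<in> special" for p
          using True that fold_id_special[of "[s]" p] by simp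
        then have "preserving (w @ [s])"
          using less.prems s(1) by (intro preserving_append) (simp_all add: preserving_def)
        from less.hyps[OF s(2) this] show ?thesis
          using fixed special by simp
      next
        case False
        then obtain k where k: "k \<le> 4" "s = f4_index k"
        proof -
          have "s = f4_index 0 \<or> s = f4_index 1 \<or> s = f4_index 2 \<or> s = f4_index 3 \<or> s = f4_index 4"
            using le_8_cases[OF s(1)] False by (auto simp: f4_index_def)
          then show ?thesis using that[of 0] that[of 1] that[of 2] that[of 3] that[of 4] by auto
        qed
        have "preserving (w @ f4_word k)"
          using less.prems k(1) by (intro preserving_append preserving_f4_word)
        from less.hyps[OF f4_word_descent[OF less.prems k(1)] this] s(2) k(2)
        obtain u where u: "u \<in> lists {..4}"
          "\<forall>p\<in>special. fold param_step (w @ f4_word k) p = fold f4_step u p"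
          by blast
        have "fold param_step w p = fold f4_step (u @ [k]) p" if "p \<in> special" for p
        proof -
          have "f4_step k (fold param_step w p) = fold f4_step u p"
            using u(2) that by simp
          \<comment> \<open>On the subspace \<open>f4_step k\<close> is an involution, so applying
            it again recovers the action of \<open>w\<close>.\<close>
          then have "f4_step k (f4_step k (fold param_step w p)) = fold f4_step (u @ [k]) p"
            by simp
          then show ?thesis
            using F4.fold_cox_eq[OF F4.square special[OF that], of k] k(1) by simp
        qed
        then show ?thesis
          using u(1) k(1) by (intro bexI[of _ "u @ [k]"]) auto
      qed
    qed
  qed
  then show ?thesis using that by blast
qed


section \<open>The symmetry group\<close>

lemma group_E8: "group W_E8"
  by (rule E8.group_coxeter_group)

text \<open>All words of a class induce the same map of parameters, so one representative
  decides.\<close>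

lemma W_E8_elem_in_Omega:
  assumes "v \<in> lists {..8}"
  shows "W_E8_elem v \<in> Omega \<longleftrightarrow> preserving v"
proof -
  have "W_E8_elem v \<in> Omega \<longleftrightarrow>
      (\<forall>w\<in>W_E8_elem v. \<forall>p\<in>special. fold param_step w p \<in> special)"
    using assms unfolding Omega_def
    by (auto simp: coxeter_group_carrier word_act_eq_fold special_def)
  also have "\<dots> \<longleftrightarrow> (\<forall>w\<in>W_E8_elem v. \<forall>p\<in>special. fold param_step v p \<in> special)"
    using E8.fold_cox_eq[of v] by (intro ball_cong) (auto simp: cox_class_def)
  finally show ?thesis
    using assms cox_class_self[OF assms] by (auto simp: preserving_def)
qed

lemma Omega_elem:
  assumes "\<rho> \<in> Omega"
  obtains v where "preserving v" "\<rho> = W_E8_elem v"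
proof -
  obtain v where "v \<in> lists {..8}" "\<rho> = W_E8_elem v"
    using assms by (auto simp: Omega_def coxeter_group_carrier)
  then show ?thesis using that W_E8_elem_in_Omega assms by blast
qed

text \<open>These letters leave \<open>F\<close> and \<open>G\<close> alone and every point is
  regular for them. The required limits are the continuity of the two coordinates, with the whole
  subspace as the dense open set.\<close>

lemma word_trivial_on_vars_id:
  assumes "v \<in> lists {0, 4, 6, 8}"
  shows "word_trivial_on_vars L v"
proof -
  have step: "i \<noteq> 2 \<and> coord_F (step L i x) = coord_F x \<and> coord_G (step L i x) = coord_G x"
    if "i \<in> {0, 4, 6, 8}" for i x
    using that by (auto simp: step_def coord_F_def coord_G_def)
  have "word_regular L v x" for x
    using assms step by (induction v arbitrary: x) (auto simp: regular_def)
  then have regular: "{x. word_regular L v x} = UNIV" by auto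
  have "coord_F (fold (step L) v x) = coord_F x \<and> coord_G (fold (step L) v x) = coord_G x" for x
    using assms by (induction v arbitrary: x) (auto simp: step)
  then have act: "word_act (step L) v coord_F = coord_F" "word_act (step L) v coord_G = coord_G"
    by (auto simp: word_act_eq_fold fun_eq_iff)
  have "continuous (at x) coord_F" "continuous (at x) coord_G" for x
    unfolding coord_F_def coord_G_def by (intro continuous_intros)+
  then have "coord_F \<midarrow>x\<rightarrow> coord_F x" "coord_G \<midarrow>x\<rightarrow> coord_G x" for x
    by (simp_all add: continuous_at)
  moreover have "x islimpt UNIV" for x :: point
    by (rule islimpt_UNIV)
  ultimately show ?thesis
    unfolding word_trivial_on_vars_def regular act
    by (intro exI[of _ "special \<times> UNIV"]) (auto intro: closure_subset[THEN subsetD])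
qed

text \<open>Triviality on the parameters forces triviality on \<open>F\<close> and \<open>G\<close>:
  by \<open>stabilizer\<close> the class contains a word in 0, 4, 6, 8, and this word is the witness
  for \<open>trivial_on_vars\<close>.\<close>

lemma W_E8_elem_in_Omega_trivial:
  assumes "v \<in> lists {..8}"
  shows "W_E8_elem v \<in> Omega_trivial L \<longleftrightarrow> (\<forall>p\<in>special. fold param_step v p = p)"
proof -
  have "trivial_on_params (W_E8_elem v) \<longleftrightarrow>
      (\<forall>w\<in>W_E8_elem v. \<forall>p\<in>special. fold param_step w p = p)"
    by (auto simp: trivial_on_params_def word_act_eq_fold coord_u_def coord_b_def param_eq_iff)
  also have "\<dots> \<longleftrightarrow> (\<forall>w\<in>W_E8_elem v. \<forall>p\<in>special. fold param_step v p = p)"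
    using E8.fold_cox_eq[of v] by (intro ball_cong) (auto simp: cox_class_def)
  finally have params: "trivial_on_params (W_E8_elem v) \<longleftrightarrow> (\<forall>p\<in>special. fold param_step v p = p)"
    using cox_class_self[OF assms] by blast
  moreover have "trivial_on_vars L (W_E8_elem v)" if "\<forall>p\<in>special. fold param_step v p = p"
    using stabilizer[OF assms] that word_trivial_on_vars_id
    by (auto simp: trivial_on_vars_def cox_class_def)
  ultimately show ?thesis
    using assms by (auto simp: Omega_trivial_def W_E8_elem_in_Omega preserving_def)
qed

section \<open>The group structure of \<open>Omega\<close> and its normal subgroup\<close>

lemma W_E8_mult:
  "preserving v \<Longrightarrow> preserving w \<Longrightarrow> W_E8_elem v \<otimes>\<^bsub>W_E8\<^esub> W_E8_elem w = W_E8_elem (v @ w)"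
  by (simp add: preserving_def coxeter_group_mult)

lemma preserving_Omega: "preserving v \<Longrightarrow> W_E8_elem v \<in> Omega"
  by (simp add: W_E8_elem_in_Omega preserving_def)

lemma preserving_trivial:
  "preserving v \<Longrightarrow> W_E8_elem v \<in> Omega_trivial L \<longleftrightarrow> (\<forall>p\<in>special. fold param_step v p = p)"
  by (simp add: W_E8_elem_in_Omega_trivial preserving_def)

lemma inv_W_E8: "preserving v \<Longrightarrow> inv\<^bsub>W_E8\<^esub> W_E8_elem v = W_E8_elem (rev v)"
  by (simp add: E8.inv_cox_class preserving_def)

lemma subgroup_Omega: "subgroup Omega W_E8"
proof (rule group.subgroupI[OF group_E8])
  show "Omega \<subseteq> carrier W_E8" by (auto simp: Omega_def)
  have "preserving []" by (simp add: preserving_def)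
  then show "Omega \<noteq> {}" using preserving_Omega by blast
qed (auto elim!: Omega_elem simp: inv_W_E8 W_E8_mult intro!: preserving_Omega preserving_rev preserving_append)

lemma group_Omega: "group Omega_group"
  by (rule group.subgroup_imp_group[OF group_E8 subgroup_Omega])

lemma inv_Omega_group: "preserving v \<Longrightarrow> inv\<^bsub>Omega_group\<^esub> W_E8_elem v = W_E8_elem (rev v)"
  using group.m_inv_consistent[OF group_E8 subgroup_Omega] preserving_Omega inv_W_E8 by simp

lemma Omega_trivial_elem:
  assumes "\<rho> \<in> Omega_trivial L"
  obtains v where "preserving v" "\<rho> = W_E8_elem v" "\<And>p. p \<in> special \<Longrightarrow> fold param_step v p = p"
proof -
  obtain v where "preserving v" "\<rho> = W_E8_elem v"
    using assms Omega_elem by (auto simp: Omega_trivial_def)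
  then show ?thesis using that assms preserving_trivial by blast
qed

lemma fold_rev_trivial:
  assumes "preserving v" "\<And>p. p \<in> special \<Longrightarrow> fold param_step v p = p" "p \<in> special"
  shows "fold param_step (rev v) p = p"
  using fold_rev_cancel(2)[of v p] assms by (simp add: preserving_def)

text \<open>\<open>Omega_trivial L\<close> is the kernel of the action of \<open>Omega\<close> on
  the subspace.\<close>

lemma normal_Omega_trivial: "Omega_trivial L \<lhd> Omega_group"
  unfolding group.normal_inv_iff[OF group_Omega]
proof (intro conjI ballI)
  show "subgroup (Omega_trivial L) Omega_group"
  proof (rule group.subgroupI[OF group_Omega])
    show "Omega_trivial L \<subseteq> carrier Omega_group" by (auto simp: Omega_trivial_def)
    show "Omega_trivial L \<noteq> {}"
      using preserving_trivial[of "[]" L] by (auto simp: preserving_def)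
  next
    fix \<rho> assume "\<rho> \<in> Omega_trivial L"
    then show "inv\<^bsub>Omega_group\<^esub> \<rho> \<in> Omega_trivial L"
      by (elim Omega_trivial_elem)
        (simp add: inv_Omega_group preserving_trivial preserving_rev fold_rev_trivial)
  next
    fix \<rho> \<sigma> assume "\<rho> \<in> Omega_trivial L" "\<sigma> \<in> Omega_trivial L"
    then show "\<rho> \<otimes>\<^bsub>Omega_group\<^esub> \<sigma> \<in> Omega_trivial L"
      by (elim Omega_trivial_elem) (simp add: W_E8_mult preserving_trivial preserving_append)
  qed
next
  fix \<rho> \<sigma> assume "\<rho> \<in> carrier Omega_group" "\<sigma> \<in> Omega_trivial L"
  then obtain v w where v: "preserving v" "\<rho> = W_E8_elem v"
    and w: "preserving w" "\<sigma> = W_E8_elem w" "\<And>p. p \<in> special \<Longrightarrow> fold param_step w p = p"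
    by (auto elim!: Omega_elem Omega_trivial_elem)
  have "fold param_step (v @ w @ rev v) p = p" if "p \<in> special" for p
    using that v(1) w(3) fold_rev_cancel(2)[of v p] by (simp add: preserving_def)
  then show "\<rho> \<otimes>\<^bsub>Omega_group\<^esub> \<sigma> \<otimes>\<^bsub>Omega_group\<^esub> inv\<^bsub>Omega_group\<^esub> \<rho> \<in> Omega_trivial L"
    using v w by (simp add: inv_Omega_group W_E8_mult preserving_append preserving_rev preserving_trivial)
qed

text \<open>Makes the quotient the group of transformations of the subspace induced by
  \<open>Omega\<close>, so that equality of cosets becomes a question about points.\<close>

lemma symmetry_class_eq_iff:
  assumes "preserving v" "preserving w"
  shows "symmetry_class L (W_E8_elem v) = symmetry_class L (W_E8_elem w)
    \<longleftrightarrow> (\<forall>p\<in>special. fold param_step v p = fold param_step w p)"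
proof
  interpret H: group Omega_group by (rule group_Omega)
  interpret N: normal "Omega_trivial L" Omega_group by (rule normal_Omega_trivial)
  have carr: "W_E8_elem v \<in> carrier Omega_group" "W_E8_elem w \<in> carrier Omega_group"
    using assms preserving_Omega by auto
  {
    assume "symmetry_class L (W_E8_elem v) = symmetry_class L (W_E8_elem w)"
    then have "W_E8_elem v \<in> Omega_trivial L #>\<^bsub>Omega_group\<^esub> W_E8_elem w"
      using H.rcos_self[OF carr(1) N.is_subgroup] by (simp add: symmetry_class_def)
    then obtain u where u: "preserving u" "\<And>p. p \<in> special \<Longrightarrow> fold param_step u p = p"
      and "W_E8_elem v = W_E8_elem u \<otimes>\<^bsub>W_E8\<^esub> W_E8_elem w"
      by (auto simp: r_coset_def elim: Omega_trivial_elem)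
    then have "cox_eq {..8} e8_matrix v (u @ w)"
      using assms by (simp add: W_E8_mult cox_class_eq_iff preserving_def)
    then show "\<forall>p\<in>special. fold param_step v p = fold param_step w p"
      using u(2) E8.fold_cox_eq by simp
  }
  assume eq: "\<forall>p\<in>special. fold param_step v p = fold param_step w p"
  have lists: "v \<in> lists {..8}" "w \<in> lists {..8}"
    using assms by (auto simp: preserving_def)
  have "preserving (v @ rev w)"
    by (intro preserving_append preserving_rev assms)
  moreover have "\<forall>p\<in>special. fold param_step (v @ rev w) p = p"
    using eq fold_rev_cancel(2)[OF lists(2)] by simp
  ultimately have "W_E8_elem (v @ rev w) \<in> Omega_trivial L"
    by (simp add: preserving_trivial)
  moreover have "W_E8_elem v = W_E8_elem (v @ rev w) \<otimes>\<^bsub>W_E8\<^esub> W_E8_elem w"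
  proof -
    have "cox_eq {..8} e8_matrix (v @ rev w @ w) (v @ [])"
      by (intro cox_eq_append[OF cox_eq.refl E8.rev_append] lists)
    then have "W_E8_elem (v @ rev w @ w) = W_E8_elem v"
      using lists by (subst cox_class_eq_iff) (auto simp: in_lists_conv_set)
    then show ?thesis
      using assms by (simp add: W_E8_mult preserving_append preserving_rev)
  qed
  ultimately have "W_E8_elem v \<in> Omega_trivial L #>\<^bsub>Omega_group\<^esub> W_E8_elem w"
    by (auto simp: r_coset_def)
  then show "symmetry_class L (W_E8_elem v) = symmetry_class L (W_E8_elem w)"
    using H.repr_independence[OF _ carr(2) N.is_subgroup] by (simp add: symmetry_class_def)
qed

lemma symmetry_class_mult:
  assumes "preserving v" "preserving w"
  shows "symmetry_class L (W_E8_elem v) \<otimes>\<^bsub>symmetry_group L\<^esub> symmetry_class L (W_E8_elem w)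
    = symmetry_class L (W_E8_elem (v @ w))"
proof -
  interpret N: normal "Omega_trivial L" Omega_group by (rule normal_Omega_trivial)
  show ?thesis
    using hom_mult[OF N.r_coset_hom_Mod, of "W_E8_elem v" "W_E8_elem w"] assms
    by (simp add: preserving_Omega W_E8_mult symmetry_class_def symmetry_group_def)
qed

lemma carrier_symmetry_group: "carrier (symmetry_group L) = symmetry_class L ` Omega"
  by (auto simp: symmetry_group_def symmetry_class_def FactGroup_def RCOSETS_def)

section \<open>The isomorphism with the Coxeter group\<close>

lemma f4_gen_eq: "f4_gen k = W_E8_elem (f4_word k)"
  by (simp add: f4_gen_def f4_word_def)

lemma symmetry_class_surj:
  assumes "x \<in> carrier (symmetry_group L)"
  obtains u where "u \<in> lists {..4}" "x = symmetry_class L (W_E8_elem (f4_subst u))"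
proof -
  obtain w where w: "preserving w" "x = symmetry_class L (W_E8_elem w)"
    using assms by (auto simp: carrier_symmetry_group elim: Omega_elem)
  obtain u where u: "u \<in> lists {..4}" "\<And>p. p \<in> special \<Longrightarrow> fold param_step w p = fold f4_step u p"
    using preserving_f4[OF w(1)] by blast
  then have "x = symmetry_class L (W_E8_elem (f4_subst u))"
    using w by (simp add: symmetry_class_eq_iff preserving_f4_subst fold_f4_subst)
  then show ?thesis using that u(1) by blast
qed

lemma symmetry_class_in_carrier:
  "preserving v \<Longrightarrow> symmetry_class L (W_E8_elem v) \<in> carrier (symmetry_group L)"
  by (simp add: carrier_symmetry_group preserving_Omega)

text \<open>Equal classes mean equal maps of the subspace. The five restricted roots are all 1 at
  \<open>base_point\<close>, so \<open>F4.faithful\<close> applies to \<open>u @ rev v\<close> and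
  shows that there are no further relations.\<close>

lemma f4_subst_class_eq_iff:
  assumes "u \<in> lists {..4}" "v \<in> lists {..4}"
  shows "symmetry_class L (W_E8_elem (f4_subst u)) = symmetry_class L (W_E8_elem (f4_subst v))
    \<longleftrightarrow> cox_eq {..4} f4_matrix u v"
proof -
  have "symmetry_class L (W_E8_elem (f4_subst u)) = symmetry_class L (W_E8_elem (f4_subst v))
      \<longleftrightarrow> (\<forall>p\<in>special. fold f4_step u p = fold f4_step v p)"
    using assms by (simp add: symmetry_class_eq_iff preserving_f4_subst fold_f4_subst)
  also have "\<dots> \<longleftrightarrow> cox_eq {..4} f4_matrix u v"
  proof
    assume eq: "\<forall>p\<in>special. fold f4_step u p = fold f4_step v p"
    have "fold f4_step (u @ rev v) p = p" if "p \<in> special" for p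
      using that eq F4.fold_cox_eq[OF F4.append_rev[OF assms(2)] that] by simp
    moreover have "f4_root i base_point = 1" if "i \<in> {..4}" for i
      using le_4_cases[of i] that by (auto simp: f4_root_def f4_index_def e8_root_base_point)
    moreover have "u @ rev v \<in> lists {..4}"
      using assms by (auto simp: in_lists_conv_set)
    ultimately have "cox_eq {..4} f4_matrix (u @ rev v) []"
      using F4.faithful[OF base_point_special] by blast
    then show "cox_eq {..4} f4_matrix u v"
      using F4.eq_rev_of_append_eq_Nil by fastforce
  qed (use F4.fold_cox_eq in blast)
  finally show ?thesis .
qed

text \<open>Substitutes the generators into an arbitrary representative;
  \<open>f4_subst_class_eq_iff\<close> gives both independence of the choice and
  injectivity.\<close>

definition f4_iso :: "complex set \<Rightarrow> nat list set \<Rightarrow> nat list set set" where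
  "f4_iso L \<rho> = symmetry_class L (W_E8_elem (f4_subst (SOME u. u \<in> \<rho>)))"

lemma f4_iso_cox_class:
  assumes "u \<in> lists {..4}"
  shows "f4_iso L (cox_class {..4} f4_matrix u) = symmetry_class L (W_E8_elem (f4_subst u))"
proof -
  have "(SOME v. v \<in> cox_class {..4} f4_matrix u) \<in> cox_class {..4} f4_matrix u"
    using cox_class_self[OF assms] by (rule someI)
  then have "cox_eq {..4} f4_matrix u (SOME v. v \<in> cox_class {..4} f4_matrix u)"
    by (simp add: cox_class_def)
  then show ?thesis
    using f4_subst_class_eq_iff cox_eq_in_lists cox_eq.sym unfolding f4_iso_def by meson
qed

lemma f4_iso_in_iso: "f4_iso L \<in> iso W_F4 (symmetry_group L)"
proof (rule isoI)
  show "f4_iso L \<in> hom W_F4 (symmetry_group L)"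
  proof (rule homI)
    fix x y assume "x \<in> carrier W_F4" "y \<in> carrier W_F4"
    then show "f4_iso L (x \<otimes>\<^bsub>W_F4\<^esub> y) = f4_iso L x \<otimes>\<^bsub>symmetry_group L\<^esub> f4_iso L y"
      by (auto simp: coxeter_group_carrier coxeter_group_mult f4_iso_cox_class
          symmetry_class_mult preserving_f4_subst)
  qed (auto simp: coxeter_group_carrier f4_iso_cox_class symmetry_class_in_carrier
      preserving_f4_subst)
  show "bij_betw (f4_iso L) (carrier W_F4) (carrier (symmetry_group L))"
    unfolding bij_betw_def
  proof
    show "inj_on (f4_iso L) (carrier W_F4)"
      by (rule inj_onI)
        (auto simp: coxeter_group_carrier f4_iso_cox_class f4_subst_class_eq_iff
          intro!: cox_class_eq_iff[THEN iffD2])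
    show "f4_iso L ` carrier W_F4 = carrier (symmetry_group L)"
      by (auto simp: coxeter_group_carrier f4_iso_cox_class symmetry_class_in_carrier
          preserving_f4_subst image_image elim!: symmetry_class_surj)
  qed
qed

lemma f4_subst_class_in_generate:
  assumes "u \<in> lists {..4}"
  shows "symmetry_class L (W_E8_elem (f4_subst u))
    \<in> generate (symmetry_group L) ((\<lambda>k. symmetry_class L (f4_gen k)) ` {..4})"
  using assms
proof (induction u)
  case Nil
  interpret N: normal "Omega_trivial L" Omega_group by (rule normal_Omega_trivial)
  have "symmetry_class L (W_E8_elem []) = \<one>\<^bsub>symmetry_group L\<^esub>"
    using hom_one[OF N.r_coset_hom_Mod group_Omega N.factorgroup_is_group]
    by (simp add: symmetry_class_def symmetry_group_def coxeter_group_one)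
  then show ?case by (simp add: generate.one)
next
  case (Cons k u)
  then have "symmetry_class L (W_E8_elem (f4_subst (k # u)))
      = symmetry_class L (f4_gen k) \<otimes>\<^bsub>symmetry_group L\<^esub> symmetry_class L (W_E8_elem (f4_subst u))"
    by (simp add: symmetry_class_mult f4_gen_eq preserving_f4_word preserving_f4_subst)
  then show ?case
    using Cons by (auto intro!: generate.eng intro: generate.incl)
qed

theorem theorem3p2:
  fixes \<omega>1 \<omega>2 :: complex and L :: "complex set"
  assumes "Im (\<omega>2 / \<omega>1) \<noteq> 0"
    and "L = period_lattice \<omega>1 \<omega>2"
  shows "subgroup Omega W_E8
    \<and> Omega_trivial L \<lhd> Omega_group
    \<and> f4_gen ` {..4} \<subseteq> Omega
    \<and> carrier (symmetry_group L)
        = generate (symmetry_group L) ((\<lambda>k. symmetry_class L (f4_gen k)) ` {..4})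
    \<and> (\<exists>\<phi> \<in> iso W_F4 (symmetry_group L).
          \<forall>k \<le> 4. \<phi> (cox_class {..4} f4_matrix [k]) = symmetry_class L (f4_gen k))"
proof (intro conjI)
  have gens: "f4_gen k \<in> Omega" if "k \<le> 4" for k
    using that by (simp add: f4_gen_eq preserving_Omega preserving_f4_word)
  then show "f4_gen ` {..4} \<subseteq> Omega" by auto
  have "group (symmetry_group L)"
    unfolding symmetry_group_def by (rule normal.factorgroup_is_group[OF normal_Omega_trivial])
  moreover have "(\<lambda>k. symmetry_class L (f4_gen k)) ` {..4} \<subseteq> carrier (symmetry_group L)"
    using gens by (auto simp: carrier_symmetry_group)
  ultimately have "generate (symmetry_group L) ((\<lambda>k. symmetry_class L (f4_gen k)) ` {..4})
      \<subseteq> carrier (symmetry_group L)"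
    by (rule group.generate_incl)
  then show "carrier (symmetry_group L)
      = generate (symmetry_group L) ((\<lambda>k. symmetry_class L (f4_gen k)) ` {..4})"
    using f4_subst_class_in_generate by (auto elim: symmetry_class_surj)
  show "\<exists>\<phi> \<in> iso W_F4 (symmetry_group L).
      \<forall>k \<le> 4. \<phi> (cox_class {..4} f4_matrix [k]) = symmetry_class L (f4_gen k)"
    using f4_iso_in_iso by (intro bexI[of _ "f4_iso L"]) (simp_all add: f4_iso_cox_class f4_gen_eq)
qed (rule subgroup_Omega normal_Omega_trivial)+

end
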